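(* Let $B$ be a finite multipermutational skew brace. Then $B$ has a Carter subbrace.
   Context: A skew (left) brace is a set $B$ with two group operations $(B,+)$ and $(B,\cdot)$ (neither assumed commutative) such that $a(b+c)=ab-a+ac$ for all $a,b,c\in B$; the two groups share the same identity $0$. The lambda map is $\lambda\colon (B,\cdot)\to\mathrm{Aut}(B,+)$, $\lambda_a(b)=-a+ab$. A subbrace of $B$ is a subset that is a subgroup of both $(B,+)$ and $(B,\cdot)$. An ideal of $B$ is a subbrace $I$ with $\lambda_b(I)\subseteq I$ for all $b\in B$ that is normal in both $(B,+)$ and $(B,\cdot)$; one can form the quotient skew brace by an ideal. $\mathrm{Soc}(B)=\ker\lambda\cap Z(B,+)$ and $Z(B)=\mathrm{Soc}(B)\cap Z(B,\cdot)$ are ideals of $B$. Put $\mathrm{Soc}_1(B)=\mathrm{Soc}(B)$, $\mathrm{Soc}_{n+1}(B)/\mathrm{Soc}_n(B)=\mathrm{Soc}(B/\mathrm{Soc}_n(B))$, and $Z_1(B)=Z(B)$, $Z_{n+1}(B)/Z_n(B)=Z(B/Z_n(B))$. $B$ is multipermutational if $\mathrm{Soc}_n(B)=B$ for some $n\ge 1$, and centrally nilpotent if $Z_n(B)=B$ for some $n\ge1$. A subbrace $C$ of $B$ is self-idealising in $B$ if it is not an ideal of any subbrace of $B$ strictly containing $C$. A Carter subbrace of $B$ is a centrally nilpotent, self-idealising subbrace of $B$. *)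

theory Defs
  imports "HOL-Algebra.QuotRing" "HOL-Algebra.Bij"
begin

text \<open>
  A skew brace is carried by the record type of rings: the additive group is
  \<^term>\<open>add_monoid B\<close> (written \<open>\<oplus>\<close>, not assumed commutative), and the
  multiplicative group is \<^term>\<open>B\<close> itself, viewed as a monoid record (written \<open>\<otimes>\<close>).
\<close>

locale skew_brace =
  fixes B (structure)
  assumes additive_group: "group (add_monoid B)"
    and multiplicative_group: "group B"
    and brace_distrib:
      "\<lbrakk>a \<in> carrier B; b \<in> carrier B; c \<in> carrier B\<rbrakk>
        \<Longrightarrow> a \<otimes> (b \<oplus> c) = (a \<otimes> b) \<oplus> (\<ominus> a) \<oplus> (a \<otimes> c)"

sublocale skew_brace \<subseteq> add: group "add_monoid B"
  rewrites "carrier (add_monoid B) = carrier B"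
    and "monoid.mult (add_monoid B) = add B"
    and "monoid.one (add_monoid B) = zero B"
    and "m_inv (add_monoid B) = a_inv B"
  by (rule additive_group) (auto simp: a_inv_def)

sublocale skew_brace \<subseteq> group B
  by (rule multiplicative_group)

lemma (in skew_brace) one_eq_zero: "\<one> = \<zero>"
proof -
  have "\<one> \<otimes> (\<zero> \<oplus> \<zero>) = (\<one> \<otimes> \<zero>) \<oplus> (\<ominus> \<one>) \<oplus> (\<one> \<otimes> \<zero>)"
    by (rule brace_distrib) simp_all
  then have "\<ominus> \<one> = \<zero>" by simp
  then have "\<ominus> (\<ominus> \<one>) = \<ominus> \<zero>" by simp
  then show ?thesis by simp
qed

text \<open>
  The values of the lambda map are restricted to the carrier because automorphisms in
  \<^const>\<open>AutoGroup\<close> are extensional functions.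
\<close>

definition lambda_map :: "('a, 'b) ring_scheme \<Rightarrow> 'a \<Rightarrow> 'a \<Rightarrow> 'a"
  where "lambda_map B a = (\<lambda>b \<in> carrier B. \<ominus>\<^bsub>B\<^esub> a \<oplus>\<^bsub>B\<^esub> (a \<otimes>\<^bsub>B\<^esub> b))"

definition group_center :: "('a, 'b) monoid_scheme \<Rightarrow> 'a set"
  where "group_center G = {z \<in> carrier G. \<forall>g \<in> carrier G. z \<otimes>\<^bsub>G\<^esub> g = g \<otimes>\<^bsub>G\<^esub> z}"

definition subbrace :: "'a set \<Rightarrow> ('a, 'b) ring_scheme \<Rightarrow> bool"
  where "subbrace C B \<longleftrightarrow> subgroup C (add_monoid B) \<and> subgroup C B"

definition brace_ideal :: "'a set \<Rightarrow> ('a, 'b) ring_scheme \<Rightarrow> bool"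
  where "brace_ideal I B \<longleftrightarrow>
    subbrace I B \<and> (\<forall>b \<in> carrier B. lambda_map B b ` I \<subseteq> I) \<and>
    I \<lhd> add_monoid B \<and> I \<lhd> B"

definition socle :: "('a, 'b) ring_scheme \<Rightarrow> 'a set"
  where "socle B =
    kernel B (AutoGroup (add_monoid B)) (lambda_map B) \<inter> group_center (add_monoid B)"

definition brace_center :: "('a, 'b) ring_scheme \<Rightarrow> 'a set"
  where "brace_center B = socle B \<inter> group_center B"

text \<open>
  For an ideal \<^term>\<open>I\<close>, the quotient skew brace is \<^term>\<open>B Quot I\<close>: its elements are the
  additive cosets of \<^term>\<open>I\<close> (which are also the multiplicative ones), with the operations
  induced by those of \<^term>\<open>B\<close>. The series are indexed from 1; index 0 only makes the
  functions total and is not used below. The term of index \<open>n + 1\<close> is the preimage of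
  the socle (centre) of the quotient by the term of index \<open>n\<close>.
\<close>

fun socle_series :: "('a, 'b) ring_scheme \<Rightarrow> nat \<Rightarrow> 'a set" where
  "socle_series B 0 = {\<zero>\<^bsub>B\<^esub>}"
| "socle_series B (Suc 0) = socle B"
| "socle_series B (Suc (Suc n)) =
    {a \<in> carrier B. socle_series B (Suc n) +>\<^bsub>B\<^esub> a \<in> socle (B Quot socle_series B (Suc n))}"

fun center_series :: "('a, 'b) ring_scheme \<Rightarrow> nat \<Rightarrow> 'a set" where
  "center_series B 0 = {\<zero>\<^bsub>B\<^esub>}"
| "center_series B (Suc 0) = brace_center B"
| "center_series B (Suc (Suc n)) =
    {a \<in> carrier B.
      center_series B (Suc n) +>\<^bsub>B\<^esub> a \<in> brace_center (B Quot center_series B (Suc n))}"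

definition multipermutational :: "('a, 'b) ring_scheme \<Rightarrow> bool"
  where "multipermutational B \<longleftrightarrow> (\<exists>n\<ge>1. socle_series B n = carrier B)"

definition centrally_nilpotent :: "('a, 'b) ring_scheme \<Rightarrow> bool"
  where "centrally_nilpotent B \<longleftrightarrow> (\<exists>n\<ge>1. center_series B n = carrier B)"

definition self_idealising :: "'a set \<Rightarrow> ('a, 'b) ring_scheme \<Rightarrow> bool"
  where "self_idealising C B \<longleftrightarrow>
    (\<nexists>D. subbrace D B \<and> C \<subset> D \<and> brace_ideal C (B\<lparr>carrier := D\<rparr>))"

definition carter_subbrace :: "'a set \<Rightarrow> ('a, 'b) ring_scheme \<Rightarrow> bool"
  where "carter_subbrace C B \<longleftrightarrow>
    subbrace C B \<and> centrally_nilpotent (B\<lparr>carrier := C\<rparr>) \<and> self_idealising C B"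

end

theory Submission
  imports Defs
begin

text \<open>
  Write \<open>\<lambda>\<close> for the lambda map. The engine is that \<open>Soc(B)\<close> is an abelian normal piece on which
  addition and multiplication agree, which acts trivially through \<open>\<lambda>\<close>, and on which conjugation is
  given by \<open>\<lambda>\<close>. It is therefore a module for the multiplicative group, its submodules are ideals,
  and its fixed points are exactly the centre of \<open>B\<close>.

  One walks down the socle series \<open>S\<^sub>n = B, \<dots>, S\<^sub>0 = 0\<close>, keeping a self-idealising subbrace
  \<open>C \<supseteq> S\<^sub>i\<close> with \<open>C / S\<^sub>i\<close> centrally nilpotent. At \<open>i = n\<close> take \<open>C = B\<close>; at \<open>i = 0\<close> such a \<open>C\<close> is
  a Carter subbrace. For the step one passes to \<open>B / S\<^sub>i\<close> and replaces \<open>C\<close> by a subbrace \<open>H\<close> of it that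
  supplements the socle \<open>N\<close> inside \<open>C\<close>, is centrally nilpotent and is self-idealising in \<open>C\<close>
  (\<open>carter_supplement\<close>). If \<open>H\<close> is an ideal of \<open>D\<close>, then \<open>C = H + N\<close> is an ideal of \<open>D + N\<close>; so
  \<open>D \<subseteq> C\<close> because \<open>C\<close> is self-idealising, and then \<open>D = H\<close> (\<open>carter_refine\<close>).

  Such an \<open>H\<close> is a maximal member of the set of centrally nilpotent supplements of \<open>N\<close>: if
  \<open>H\<close> is an ideal of a subbrace \<open>D\<close>, then \<open>D\<close> acts on \<open>D \<inter> N\<close> modulo \<open>H \<inter> N\<close> trivially, and on
  \<open>H \<inter> N\<close> as nilpotently as \<open>H\<close> does, because \<open>D = H (D \<inter> N)\<close> and \<open>N\<close> acts trivially. So \<open>D\<close> is itself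
  a centrally nilpotent supplement, and \<open>D = H\<close>.

  That the set is not empty is the main point: a minimal supplement of \<open>N\<close> is centrally nilpotent.
  Conjugacy arguments are of no use here, since multiplicative conjugation does not respect the
  addition. If the claim fails, some quotient of the minimal supplement has trivial centre, while all
  its proper quotients are centrally nilpotent, and it has a minimal ideal \<open>P\<close> in the image of \<open>N\<close>;
  it suffices to find a proper supplement of \<open>P\<close> (\<open>minimal_ideal_supplement\<close>). The source of
  supplements is the following observation. If \<open>z\<close> is central modulo \<open>P\<close>, then \<open>z k\<close> and \<open>k z\<close> differ by
  an element of \<open>P\<close>, which acts trivially; so \<open>\<lambda>\<^sub>z\<close> commutes with every \<open>\<lambda>\<^sub>k\<close>, and the fixed points of
  \<open>\<lambda>\<^sub>z\<close> form a subbrace. When \<open>z\<close> moves a point of \<open>P\<close>, minimality makes \<open>\<lambda>\<^sub>z - 1\<close> bijective on \<open>P\<close>,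
  and the fixed points form a complement of \<open>P\<close>. When no such \<open>z\<close> exists, an element deeper in the
  upper central series takes its place, but only to show that the centre modulo \<open>P\<close> would contain
  nonzero elements of the centre, which is a contradiction.
\<close>
section \<open>Calculus in a skew brace\<close>

context skew_brace
begin

text \<open>
  Unlike \<^const>\<open>lambda_map\<close>, this is not cut off outside the carrier, so that it rewrites freely.
\<close>

definition lam :: "'a \<Rightarrow> 'a \<Rightarrow> 'a"
  where "lam a b = \<ominus> a \<oplus> (a \<otimes> b)"

lemma lam_closed [simp]: "\<lbrakk>a \<in> carrier B; b \<in> carrier B\<rbrakk> \<Longrightarrow> lam a b \<in> carrier B"
  by (simp add: lam_def)

lemma mult_eq_add_lam: "\<lbrakk>a \<in> carrier B; b \<in> carrier B\<rbrakk> \<Longrightarrow> a \<otimes> b = a \<oplus> lam a b"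
  by (simp add: lam_def add.m_assoc [symmetric])

lemma lam_eqI:
  "\<lbrakk>a \<in> carrier B; b \<in> carrier B; c \<in> carrier B; a \<otimes> b = a \<oplus> c\<rbrakk> \<Longrightarrow> lam a b = c"
  by (simp add: lam_def add.m_assoc [symmetric])

lemma lam_add:
  "\<lbrakk>a \<in> carrier B; b \<in> carrier B; c \<in> carrier B\<rbrakk> \<Longrightarrow> lam a (b \<oplus> c) = lam a b \<oplus> lam a c"
  by (simp add: lam_def brace_distrib add.m_assoc)

lemma lam_mult:
  assumes [simp]: "a \<in> carrier B" "b \<in> carrier B" "c \<in> carrier B"
  shows "lam (a \<otimes> b) c = lam a (lam b c)"
proof (rule lam_eqI)
  have "a \<otimes> b \<otimes> c = a \<otimes> (b \<oplus> lam b c)"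
    by (simp add: m_assoc mult_eq_add_lam [symmetric])
  also have "\<dots> = (a \<otimes> b) \<oplus> (\<ominus> a) \<oplus> (a \<otimes> lam b c)"
    by (simp add: brace_distrib)
  also have "\<dots> = (a \<otimes> b) \<oplus> lam a (lam b c)"
    by (simp add: lam_def add.m_assoc)
  finally show "a \<otimes> b \<otimes> c = a \<otimes> b \<oplus> lam a (lam b c)" .
qed simp_all

lemma zero_mult [simp]: "a \<in> carrier B \<Longrightarrow> \<zero> \<otimes> a = a"
  and mult_zero [simp]: "a \<in> carrier B \<Longrightarrow> a \<otimes> \<zero> = a"
  using l_one r_one by (simp_all add: one_eq_zero)

lemma lam_zero_left [simp]: "a \<in> carrier B \<Longrightarrow> lam \<zero> a = a"
  by (rule lam_eqI) simp_all

lemma lam_zero_right [simp]: "a \<in> carrier B \<Longrightarrow> lam a \<zero> = \<zero>"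
  by (rule lam_eqI) simp_all

lemma eq_minusI:
  assumes "a \<in> carrier B" "b \<in> carrier B" "a \<oplus> b = \<zero>"
  shows "b = \<ominus> a"
  using assms add.inv_comm [of a b] add.inv_equality [of b a] by simp

lemma eq_invI:
  assumes "a \<in> carrier B" "b \<in> carrier B" "a \<otimes> b = \<zero>"
  shows "b = inv a"
  using assms inv_comm [of a b] inv_equality [of b a] by (simp add: one_eq_zero)

lemma lam_lam_inv:
  "\<lbrakk>a \<in> carrier B; b \<in> carrier B\<rbrakk> \<Longrightarrow> lam a (lam (inv a) b) = b"
  "\<lbrakk>a \<in> carrier B; b \<in> carrier B\<rbrakk> \<Longrightarrow> lam (inv a) (lam a b) = b"
  by (simp_all add: lam_mult [symmetric] one_eq_zero)

lemma lam_minus: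
  assumes [simp]: "a \<in> carrier B" "b \<in> carrier B"
  shows "lam a (\<ominus> b) = \<ominus> lam a b"
proof -
  have "lam a b \<oplus> lam a (\<ominus> b) = \<zero>"
    by (simp add: lam_add [symmetric])
  then show ?thesis
    using eq_minusI by simp
qed

lemma add_eq_mult_lam_inv:
  "\<lbrakk>a \<in> carrier B; b \<in> carrier B\<rbrakk> \<Longrightarrow> a \<oplus> b = a \<otimes> lam (inv a) b"
  by (simp add: mult_eq_add_lam lam_lam_inv)

lemma inv_eq_minus_lam:
  assumes [simp]: "a \<in> carrier B"
  shows "inv a = \<ominus> lam (inv a) a"
proof -
  have "inv a \<oplus> lam (inv a) a = \<zero>"
    by (simp add: mult_eq_add_lam [symmetric] one_eq_zero)
  then show ?thesis
    using add.inv_equality by fastforce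
qed

lemma lambda_map_eq_lam: "b \<in> carrier B \<Longrightarrow> lambda_map B a b = lam a b"
  by (simp add: lambda_map_def lam_def)

end

section \<open>Subbraces and ideals\<close>

context skew_brace
begin

text \<open>
  The following two criteria mention neither inverses nor the lambda map. They therefore read the
  same in a skew brace and after restriction of its carrier, and they transport along
  homomorphisms. The two existence statements about \<open>x \<otimes> i\<close> in the second one say that \<open>I\<close> is
  invariant under the lambda map and normal in the multiplicative group.
\<close>

lemma subbrace_iff:
  "subbrace C B \<longleftrightarrow> C \<subseteq> carrier B \<and> \<zero> \<in> C \<and> (\<forall>a\<in>C. \<forall>b\<in>C. a \<oplus> b \<in> C \<and> a \<otimes> b \<in> C) \<and>
    (\<forall>a\<in>C. (\<exists>b\<in>C. a \<oplus> b = \<zero>) \<and> (\<exists>b\<in>C. a \<otimes> b = \<zero>))" (is "?L \<longleftrightarrow> ?R")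
proof
  assume L: ?L
  interpret A: subgroup C "add_monoid B" using L by (simp add: subbrace_def)
  interpret M: subgroup C B using L by (simp add: subbrace_def)
  show ?R
  proof (intro conjI ballI)
    fix a assume a: "a \<in> C"
    then have "a \<in> carrier B" "\<ominus> a \<in> C"
      using A.subset A.m_inv_closed [of a] by (auto simp: a_inv_def)
    then show "\<exists>b\<in>C. a \<oplus> b = \<zero>" by (intro bexI [of _ "\<ominus> a"]) simp_all
    have "a \<in> carrier B" "inv a \<in> C"
      using a M.subset M.m_inv_closed [of a] by auto
    then show "\<exists>b\<in>C. a \<otimes> b = \<zero>" by (intro bexI [of _ "inv a"]) (simp_all add: one_eq_zero)
  qed (use A.subset A.one_closed A.m_closed M.m_closed in auto)
next
  assume R: ?R
  then have car: "C \<subseteq> carrier B" and zero: "\<zero> \<in> C"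
    and closed: "\<forall>a\<in>C. \<forall>b\<in>C. a \<oplus> b \<in> C \<and> a \<otimes> b \<in> C"
    and inverse: "\<forall>a\<in>C. (\<exists>b\<in>C. a \<oplus> b = \<zero>) \<and> (\<exists>b\<in>C. a \<otimes> b = \<zero>)"
    by - (elim conjE, assumption)+
  have "\<ominus> a \<in> C" "inv a \<in> C" if a: "a \<in> C" for a
  proof -
    obtain b c where "b \<in> C" "a \<oplus> b = \<zero>" "c \<in> C" "a \<otimes> c = \<zero>"
      using inverse a by blast
    moreover have "b \<in> carrier B" "c \<in> carrier B" "a \<in> carrier B"
      using \<open>b \<in> C\<close> \<open>c \<in> C\<close> that car by (simp_all add: subsetD)
    ultimately show "\<ominus> a \<in> C" "inv a \<in> C"
      using \<open>b \<in> carrier B\<close> \<open>c \<in> carrier B\<close> \<open>a \<in> carrier B\<close> eq_minusI [of a b] eq_invI [of a c] by simp_all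
  qed
  then show ?L
    using car zero closed add.subgroupI [of C] subgroupI [of C] by (auto simp: subbrace_def)
qed

lemma brace_ideal_iff:
  "brace_ideal I B \<longleftrightarrow> I \<subseteq> carrier B \<and> \<zero> \<in> I \<and> (\<forall>a\<in>I. \<forall>b\<in>I. a \<oplus> b \<in> I) \<and>
    (\<forall>a\<in>I. \<exists>b\<in>I. a \<oplus> b = \<zero>) \<and>
    (\<forall>x\<in>carrier B. \<forall>i\<in>I. (\<exists>j\<in>I. x \<oplus> i = j \<oplus> x) \<and> (\<exists>j\<in>I. x \<otimes> i = x \<oplus> j) \<and>
      (\<exists>j\<in>I. x \<otimes> i = j \<otimes> x))" (is "?L \<longleftrightarrow> ?R")
proof
  assume L: ?L
  then have sub: "subbrace I B" and lam: "\<And>x i. \<lbrakk>x \<in> carrier B; i \<in> I\<rbrakk> \<Longrightarrow> lambda_map B x i \<in> I"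
    and A: "I \<lhd> add_monoid B" and M: "I \<lhd> B"
    by (auto simp: brace_ideal_def)
  have car: "I \<subseteq> carrier B" using sub by (simp add: subbrace_iff)
  have "(\<exists>j\<in>I. x \<oplus> i = j \<oplus> x) \<and> (\<exists>j\<in>I. x \<otimes> i = x \<oplus> j) \<and> (\<exists>j\<in>I. x \<otimes> i = j \<otimes> x)"
    if x: "x \<in> carrier B" and i: "i \<in> I" for x i
  proof (intro conjI)
    have [simp]: "x \<in> carrier B" "i \<in> carrier B" using x i car by auto
    have "x \<oplus> i \<oplus> \<ominus> x \<in> I" "x \<oplus> i = (x \<oplus> i \<oplus> \<ominus> x) \<oplus> x"
      using normal.inv_op_closed2 [OF A, of x i] x i
      by (simp_all add: a_inv_def [symmetric] add.m_assoc)
    then show "\<exists>j\<in>I. x \<oplus> i = j \<oplus> x" by blast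
    have "x \<otimes> i \<otimes> inv x \<in> I" "x \<otimes> i = (x \<otimes> i \<otimes> inv x) \<otimes> x"
      using normal.inv_op_closed2 [OF M, of x i] x i by (simp_all add: m_assoc)
    then show "\<exists>j\<in>I. x \<otimes> i = j \<otimes> x" by blast
    have "lam x i \<in> I" "x \<otimes> i = x \<oplus> lam x i"
      using lam [OF x i] by (simp_all add: lambda_map_eq_lam mult_eq_add_lam)
    then show "\<exists>j\<in>I. x \<otimes> i = x \<oplus> j" by blast
  qed
  then show ?R using sub by (simp add: subbrace_iff)
next
  assume R: ?R
  then have car: "I \<subseteq> carrier B" and zero: "\<zero> \<in> I" and add: "\<forall>a\<in>I. \<forall>b\<in>I. a \<oplus> b \<in> I"
    and neg: "\<forall>a\<in>I. \<exists>b\<in>I. a \<oplus> b = \<zero>"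
    and conj: "\<forall>x\<in>carrier B. \<forall>i\<in>I. (\<exists>j\<in>I. x \<oplus> i = j \<oplus> x) \<and> (\<exists>j\<in>I. x \<otimes> i = x \<oplus> j) \<and>
      (\<exists>j\<in>I. x \<otimes> i = j \<otimes> x)"
    by - (elim conjE, assumption)+
  have minus: "\<ominus> a \<in> I" if a: "a \<in> I" for a
  proof -
    obtain b where "b \<in> I" "a \<oplus> b = \<zero>" using neg a by blast
    then show ?thesis using eq_minusI [of a b] car that by blast
  qed
  have lam: "lam x i \<in> I" if xi: "x \<in> carrier B" "i \<in> I" for x i
  proof -
    obtain j where "j \<in> I" "x \<otimes> i = x \<oplus> j" using conj xi by meson
    then show ?thesis using lam_eqI [of x i j] car that by auto
  qed
  have mult: "a \<otimes> b \<in> I" if "a \<in> I" "b \<in> I" for a b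
    using that car add lam by (auto simp: mult_eq_add_lam subset_iff)
  have inv: "inv a \<in> I" if "a \<in> I" for a
    using inv_eq_minus_lam [of a] that car minus lam [of "inv a" a] by (metis inv_closed subsetD)
  have A: "subgroup I (add_monoid B)"
    using add.subgroupI [of I] car add minus zero by auto
  have M: "subgroup I B"
    using subgroupI [of I] car mult inv zero by auto
  have "x \<oplus> i \<oplus> \<ominus> x \<in> I" "x \<otimes> i \<otimes> inv x \<in> I" if x: "x \<in> carrier B" "i \<in> I" for x i
  proof -
    obtain j k where "j \<in> I" "x \<oplus> i = j \<oplus> x" "k \<in> I" "x \<otimes> i = k \<otimes> x" using conj x by meson
    moreover have "j \<in> carrier B" "k \<in> carrier B" using calculation car by auto
    ultimately show "x \<oplus> i \<oplus> \<ominus> x \<in> I" "x \<otimes> i \<otimes> inv x \<in> I"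
      using x by (simp_all add: add.m_assoc m_assoc)
  qed
  then have "I \<lhd> add_monoid B" "I \<lhd> B"
    using add.normal_inv_iff [of I] normal_inv_iff [of I] A M by auto
  then show ?L
    using A M lam car by (auto simp: brace_ideal_def subbrace_def lambda_map_eq_lam subset_iff)
qed

lemma subbrace_closed:
  assumes "subbrace C B"
  shows "C \<subseteq> carrier B" "\<zero> \<in> C" "\<And>a b. \<lbrakk>a \<in> C; b \<in> C\<rbrakk> \<Longrightarrow> a \<oplus> b \<in> C"
    "\<And>a b. \<lbrakk>a \<in> C; b \<in> C\<rbrakk> \<Longrightarrow> a \<otimes> b \<in> C" "\<And>a. a \<in> C \<Longrightarrow> \<ominus> a \<in> C" "\<And>a. a \<in> C \<Longrightarrow> inv a \<in> C"
    "\<And>a b. \<lbrakk>a \<in> C; b \<in> C\<rbrakk> \<Longrightarrow> lam a b \<in> C"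
proof -
  interpret A: subgroup C "add_monoid B" using assms by (simp add: subbrace_def)
  interpret M: subgroup C B using assms by (simp add: subbrace_def)
  show "C \<subseteq> carrier B" "\<zero> \<in> C" "\<And>a b. \<lbrakk>a \<in> C; b \<in> C\<rbrakk> \<Longrightarrow> a \<oplus> b \<in> C"
    "\<And>a b. \<lbrakk>a \<in> C; b \<in> C\<rbrakk> \<Longrightarrow> a \<otimes> b \<in> C" "\<And>a. a \<in> C \<Longrightarrow> inv a \<in> C"
    using assms by (auto simp: subbrace_iff)
  then show "\<And>a. a \<in> C \<Longrightarrow> \<ominus> a \<in> C" "\<And>a b. \<lbrakk>a \<in> C; b \<in> C\<rbrakk> \<Longrightarrow> lam a b \<in> C"
    using A.m_inv_closed by (auto simp: a_inv_def lam_def)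
qed

lemma ideal_imp_subbrace: "brace_ideal I B \<Longrightarrow> subbrace I B"
  by (simp add: brace_ideal_def)

lemma ideal_lam_closed:
  assumes "brace_ideal I B" "x \<in> carrier B" "i \<in> I"
  shows "lam x i \<in> I"
proof -
  have "i \<in> carrier B" using assms by (auto simp: brace_ideal_iff)
  moreover have "lambda_map B x i \<in> I" using assms by (auto simp: brace_ideal_def)
  ultimately show ?thesis by (simp add: lambda_map_eq_lam)
qed

text \<open>
  Closure under multiplicative inverses comes for free from \<open>inv a = \<ominus> lam (inv a) a\<close>.
\<close>

lemma left_ideal_imp_subbrace:
  assumes car: "L \<subseteq> carrier B" and zero: "\<zero> \<in> L"
    and add: "\<And>a b. \<lbrakk>a \<in> L; b \<in> L\<rbrakk> \<Longrightarrow> a \<oplus> b \<in> L" and minus: "\<And>a. a \<in> L \<Longrightarrow> \<ominus> a \<in> L"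
    and lam: "\<And>x a. \<lbrakk>x \<in> carrier B; a \<in> L\<rbrakk> \<Longrightarrow> lam x a \<in> L"
  shows "subbrace L B"
proof -
  have "a \<otimes> b \<in> L" if "a \<in> L" "b \<in> L" for a b
    using that car add lam by (auto simp: mult_eq_add_lam subset_iff)
  moreover have "\<exists>b\<in>L. a \<otimes> b = \<zero>" if "a \<in> L" for a
  proof
    have a: "a \<in> carrier B" using that car by auto
    show "inv a \<in> L"
      using inv_eq_minus_lam [OF a] that minus lam [of "inv a" a] a by (metis inv_closed)
    show "a \<otimes> inv a = \<zero>" using a by (simp add: one_eq_zero)
  qed
  moreover have "\<exists>b\<in>L. a \<oplus> b = \<zero>" if "a \<in> L" for a
    using that minus car by (intro bexI [of _ "\<ominus> a"]) auto
  ultimately show ?thesis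
    using assms by (auto simp: subbrace_iff)
qed

lemma subbrace_restrict_is_skew_brace:
  assumes "subbrace C B"
  shows "skew_brace (B\<lparr>carrier := C\<rparr>)"
proof (rule skew_brace.intro)
  have A: "subgroup C (add_monoid B)" and M: "subgroup C B"
    using assms by (auto simp: subbrace_def)
  have *: "add_monoid (B\<lparr>carrier := C\<rparr>) = (add_monoid B)\<lparr>carrier := C\<rparr>" by simp
  show "Group.group (add_monoid (B\<lparr>carrier := C\<rparr>))"
    unfolding * by (rule subgroup.subgroup_is_group [OF A additive_group])
  show "Group.group (B\<lparr>carrier := C\<rparr>)"
    by (rule subgroup.subgroup_is_group [OF M multiplicative_group])
  fix a b c
  assume "a \<in> carrier (B\<lparr>carrier := C\<rparr>)" "b \<in> carrier (B\<lparr>carrier := C\<rparr>)" "c \<in> carrier (B\<lparr>carrier := C\<rparr>)"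
  then have in_C: "a \<in> C" "b \<in> C" "c \<in> C" by auto
  then have "a \<in> carrier B" "b \<in> carrier B" "c \<in> carrier B"
    using subbrace_closed(1) [OF assms] by auto
  moreover have "\<ominus>\<^bsub>B\<lparr>carrier := C\<rparr>\<^esub> a = \<ominus> a"
    using add.m_inv_consistent [OF A] in_C by (simp add: a_inv_def)
  ultimately show "a \<otimes>\<^bsub>B\<lparr>carrier := C\<rparr>\<^esub> (b \<oplus>\<^bsub>B\<lparr>carrier := C\<rparr>\<^esub> c) =
      (a \<otimes>\<^bsub>B\<lparr>carrier := C\<rparr>\<^esub> b) \<oplus>\<^bsub>B\<lparr>carrier := C\<rparr>\<^esub> (\<ominus>\<^bsub>B\<lparr>carrier := C\<rparr>\<^esub> a) \<oplus>\<^bsub>B\<lparr>carrier := C\<rparr>\<^esub>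
      (a \<otimes>\<^bsub>B\<lparr>carrier := C\<rparr>\<^esub> c)"
    by (simp add: brace_distrib)
qed

lemma subbrace_restrict_iff:
  assumes "subbrace C B"
  shows "subbrace D (B\<lparr>carrier := C\<rparr>) \<longleftrightarrow> subbrace D B \<and> D \<subseteq> C"
  using subbrace_closed(1) [OF assms]
  unfolding subbrace_iff skew_brace.subbrace_iff [OF subbrace_restrict_is_skew_brace [OF assms]]
  by auto

end

section \<open>Surjective homomorphisms and quotients\<close>

locale brace_epi = skew_brace K + Q: skew_brace Q
  for K :: "('a, 'm) ring_scheme" (structure) and Q :: "('b, 'n) ring_scheme" and f :: "'a \<Rightarrow> 'b" +
  assumes surj: "f ` carrier K = carrier Q"
    and hom_add: "\<lbrakk>x \<in> carrier K; y \<in> carrier K\<rbrakk> \<Longrightarrow> f (x \<oplus> y) = f x \<oplus>\<^bsub>Q\<^esub> f y"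
    and hom_mult: "\<lbrakk>x \<in> carrier K; y \<in> carrier K\<rbrakk> \<Longrightarrow> f (x \<otimes> y) = f x \<otimes>\<^bsub>Q\<^esub> f y"
begin

definition pull :: "'b set \<Rightarrow> 'a set"
  where "pull S = {x \<in> carrier K. f x \<in> S}"

lemma hom_closed [simp]: "x \<in> carrier K \<Longrightarrow> f x \<in> carrier Q"
  using surj by blast

lemma lift: "q \<in> carrier Q \<Longrightarrow> \<exists>x\<in>carrier K. f x = q"
  by (metis surj imageE)

lemma hom_zero [simp]: "f \<zero> = \<zero>\<^bsub>Q\<^esub>"
proof -
  have "f \<zero> \<oplus>\<^bsub>Q\<^esub> f \<zero> = f \<zero>" by (simp add: hom_add [symmetric])
  then show ?thesis by simp
qed

lemma hom_minus: "x \<in> carrier K \<Longrightarrow> f (\<ominus> x) = \<ominus>\<^bsub>Q\<^esub> f x"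
  by (rule Q.eq_minusI) (simp_all add: hom_add [symmetric])

lemma pull_subset: "pull S \<subseteq> carrier K"
  by (auto simp: pull_def)

lemma pull_mono: "S \<subseteq> T \<Longrightarrow> pull S \<subseteq> pull T"
  by (auto simp: pull_def)

lemma image_pull: "S \<subseteq> carrier Q \<Longrightarrow> f ` pull S = S"
  by (auto simp: pull_def image_iff) (metis lift subsetD)

lemma pull_carrier [simp]: "pull (carrier Q) = carrier K"
  by (auto simp: pull_def)

lemma pull_image:
  assumes "subbrace C K" "pull {\<zero>\<^bsub>Q\<^esub>} \<subseteq> C"
  shows "pull (f ` C) = C"
proof
  show "C \<subseteq> pull (f ` C)"
    using subbrace_closed(1) [OF assms(1)] by (auto simp: pull_def)
  show "pull (f ` C) \<subseteq> C"
  proof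
    fix x assume "x \<in> pull (f ` C)"
    then obtain c where x: "x \<in> carrier K" and c: "c \<in> C" "f x = f c"
      by (auto simp: pull_def)
    have c': "c \<in> carrier K" using c subbrace_closed(1) [OF assms(1)] by auto
    have "f (x \<oplus> \<ominus> c) = \<zero>\<^bsub>Q\<^esub>" using x c c' by (simp add: hom_add hom_minus)
    then have "x \<oplus> \<ominus> c \<in> C" using assms(2) x c' by (auto simp: pull_def)
    then have "(x \<oplus> \<ominus> c) \<oplus> c \<in> C" using c subbrace_closed(3) [OF assms(1)] by blast
    then show "x \<in> C" using x c' by (simp add: add.m_assoc)
  qed
qed

lemma subbrace_pull:
  assumes "subbrace C Q" shows "subbrace (pull C) K"
proof -
  have "\<exists>b\<in>pull C. a \<oplus> b = \<zero>" "\<exists>b\<in>pull C. a \<otimes> b = \<zero>" if "a \<in> pull C" for a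
  proof -
    have a: "a \<in> carrier K" "f a \<in> C" using that by (auto simp: pull_def)
    show "\<exists>b\<in>pull C. a \<oplus> b = \<zero>"
      using a Q.subbrace_closed(5) [OF assms] by (intro bexI [of _ "\<ominus> a"]) (auto simp: pull_def hom_minus)
    have "f a \<otimes>\<^bsub>Q\<^esub> f (inv a) = \<zero>\<^bsub>Q\<^esub>"
      using a by (simp add: hom_mult [symmetric] one_eq_zero)
    then have "f (inv a) = inv\<^bsub>Q\<^esub> f a" using Q.eq_invI a by simp
    then have "inv a \<in> pull C"
      using a Q.subbrace_closed(6) [OF assms] by (auto simp: pull_def)
    then show "\<exists>b\<in>pull C. a \<otimes> b = \<zero>"
      using a by (intro bexI [of _ "inv a"]) (auto simp: one_eq_zero)
  qed
  then show ?thesis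
    using Q.subbrace_closed(1-4) [OF assms] unfolding subbrace_iff
    by (auto simp: pull_def hom_add hom_mult)
qed

lemma subbrace_image:
  assumes "subbrace C K" shows "subbrace (f ` C) Q"
proof -
  have car: "x \<in> carrier K" if "x \<in> C" for x
    using subbrace_closed(1) [OF assms] that by auto
  have "\<exists>b\<in>f ` C. f a \<oplus>\<^bsub>Q\<^esub> b = \<zero>\<^bsub>Q\<^esub>" "\<exists>b\<in>f ` C. f a \<otimes>\<^bsub>Q\<^esub> b = \<zero>\<^bsub>Q\<^esub>" if "a \<in> C" for a
  proof -
    show "\<exists>b\<in>f ` C. f a \<oplus>\<^bsub>Q\<^esub> b = \<zero>\<^bsub>Q\<^esub>"
      using that car subbrace_closed(5) [OF assms]
      by (intro bexI [of _ "f (\<ominus> a)"]) (simp_all add: hom_add [symmetric] del: hom_minus)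
    have "f a \<otimes>\<^bsub>Q\<^esub> f (inv a) = \<zero>\<^bsub>Q\<^esub>"
      using that car by (simp add: hom_mult [symmetric] one_eq_zero)
    then show "\<exists>b\<in>f ` C. f a \<otimes>\<^bsub>Q\<^esub> b = \<zero>\<^bsub>Q\<^esub>"
      using that subbrace_closed(6) [OF assms] by blast
  qed
  moreover have "a \<oplus>\<^bsub>Q\<^esub> b \<in> f ` C" "a \<otimes>\<^bsub>Q\<^esub> b \<in> f ` C" if "a \<in> f ` C" "b \<in> f ` C" for a b
    using that car subbrace_closed(3,4) [OF assms] by (auto simp: hom_add [symmetric] hom_mult [symmetric])
  moreover have "\<zero>\<^bsub>Q\<^esub> \<in> f ` C"
    using subbrace_closed(2) [OF assms] hom_zero by (metis imageI)
  ultimately show ?thesis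
    using car unfolding Q.subbrace_iff by (simp add: image_subset_iff)
qed

lemma hom_lam: "\<lbrakk>a \<in> carrier K; b \<in> carrier K\<rbrakk> \<Longrightarrow> f (lam a b) = Q.lam (f a) (f b)"
  by (simp add: lam_def Q.lam_def hom_add hom_minus hom_mult)

lemma mem_coset_pull_iff:
  assumes x: "x \<in> carrier K" and y: "y \<in> carrier K" and S: "S \<subseteq> carrier Q"
  shows "x \<in> pull S +>\<^bsub>K\<^esub> y \<longleftrightarrow> f x \<in> S +>\<^bsub>Q\<^esub> f y"
proof
  assume "x \<in> pull S +>\<^bsub>K\<^esub> y"
  then show "f x \<in> S +>\<^bsub>Q\<^esub> f y"
    using y by (auto simp: pull_def a_r_coset_def' hom_add)
next
  assume "f x \<in> S +>\<^bsub>Q\<^esub> f y"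
  then obtain s where s: "s \<in> S" "f x = s \<oplus>\<^bsub>Q\<^esub> f y" by (auto simp: a_r_coset_def')
  moreover have "s \<in> carrier Q" using s S by auto
  ultimately have "f (x \<oplus> \<ominus> y) = s"
    using x y by (simp add: hom_add hom_minus Q.add.m_assoc)
  then have "x \<oplus> \<ominus> y \<in> pull S" "x = (x \<oplus> \<ominus> y) \<oplus> y"
    using s x y by (simp_all add: pull_def add.m_assoc)
  then show "x \<in> pull S +>\<^bsub>K\<^esub> y"
    by (auto simp: a_r_coset_def')
qed

lemma ideal_pull:
  assumes I: "brace_ideal I Q" shows "brace_ideal (pull I) K"
proof -
  have car: "I \<subseteq> carrier Q" using I by (simp add: Q.brace_ideal_iff)
  have sub: "subbrace (pull I) K" using subbrace_pull I Q.ideal_imp_subbrace by blast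
  have *: "\<exists>j\<in>pull I. y = j \<oplus> x" if "x \<in> carrier K" "y \<in> carrier K" "\<exists>j\<in>I. f y = j \<oplus>\<^bsub>Q\<^esub> f x" for x y
    using mem_coset_pull_iff [OF that(2,1) car] that(3) by (auto simp: a_r_coset_def')
  have "(\<exists>j\<in>pull I. x \<oplus> i = j \<oplus> x) \<and> (\<exists>j\<in>pull I. x \<otimes> i = x \<oplus> j) \<and> (\<exists>j\<in>pull I. x \<otimes> i = j \<otimes> x)"
    if x: "x \<in> carrier K" and i: "i \<in> pull I" for x i
  proof (intro conjI)
    have i': "i \<in> carrier K" "f i \<in> I" using i by (auto simp: pull_def)
    have norm: "(\<exists>j\<in>I. f x \<oplus>\<^bsub>Q\<^esub> f i = j \<oplus>\<^bsub>Q\<^esub> f x)" "(\<exists>j\<in>I. f x \<otimes>\<^bsub>Q\<^esub> f i = j \<otimes>\<^bsub>Q\<^esub> f x)"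
      using I x i' unfolding Q.brace_ideal_iff by (meson hom_closed)+
    then show "\<exists>j\<in>pull I. x \<oplus> i = j \<oplus> x"
      using * [of x "x \<oplus> i"] x i' by (simp add: hom_add)
    have "lam x i \<in> pull I"
      using Q.ideal_lam_closed [OF I] x i' by (simp add: pull_def hom_lam)
    then show "\<exists>j\<in>pull I. x \<otimes> i = x \<oplus> j"
      using x i' mult_eq_add_lam by blast
    obtain j where j: "j \<in> I" "f x \<otimes>\<^bsub>Q\<^esub> f i = j \<otimes>\<^bsub>Q\<^esub> f x" using norm(2) by blast
    moreover have "j \<in> carrier Q" using j car by auto
    moreover have "f (x \<otimes> i \<otimes> inv x) \<otimes>\<^bsub>Q\<^esub> f x = f x \<otimes>\<^bsub>Q\<^esub> f i"
      using x i' by (simp add: hom_mult [symmetric] m_assoc)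
    ultimately have "f (x \<otimes> i \<otimes> inv x) = j"
      using x i' Q.right_cancel [of "f x" "f (x \<otimes> i \<otimes> inv x)" j] by simp
    then have "x \<otimes> i \<otimes> inv x \<in> pull I" "x \<otimes> i = (x \<otimes> i \<otimes> inv x) \<otimes> x"
      using j x i' by (simp_all add: pull_def m_assoc)
    then show "\<exists>j\<in>pull I. x \<otimes> i = j \<otimes> x" by blast
  qed
  then show ?thesis
    using sub unfolding brace_ideal_iff subbrace_iff by blast
qed

lemma ideal_image:
  assumes I: "brace_ideal I K" shows "brace_ideal (f ` I) Q"
proof -
  have car: "x \<in> carrier K" if "x \<in> I" for x
    using I that by (auto simp: brace_ideal_iff)
  have sub: "subbrace (f ` I) Q" using subbrace_image I ideal_imp_subbrace by blast
  have "(\<exists>j\<in>f ` I. q \<oplus>\<^bsub>Q\<^esub> f i = j \<oplus>\<^bsub>Q\<^esub> q) \<and> (\<exists>j\<in>f ` I. q \<otimes>\<^bsub>Q\<^esub> f i = q \<oplus>\<^bsub>Q\<^esub> j) \<and>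
      (\<exists>j\<in>f ` I. q \<otimes>\<^bsub>Q\<^esub> f i = j \<otimes>\<^bsub>Q\<^esub> q)"
    if q: "q \<in> carrier Q" and i: "i \<in> I" for q i
  proof -
    obtain x where x: "x \<in> carrier K" "q = f x" using q lift by blast
    obtain j k l where "j \<in> I" "x \<oplus> i = j \<oplus> x" "k \<in> I" "x \<otimes> i = x \<oplus> k" "l \<in> I" "x \<otimes> i = l \<otimes> x"
      using I x i unfolding brace_ideal_iff by meson
    then have "f x \<oplus>\<^bsub>Q\<^esub> f i = f j \<oplus>\<^bsub>Q\<^esub> f x" "f x \<otimes>\<^bsub>Q\<^esub> f i = f x \<oplus>\<^bsub>Q\<^esub> f k" "f x \<otimes>\<^bsub>Q\<^esub> f i = f l \<otimes>\<^bsub>Q\<^esub> f x"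
      using x i car by (metis hom_add, metis hom_add hom_mult, metis hom_mult)
    then show ?thesis using x \<open>j \<in> I\<close> \<open>k \<in> I\<close> \<open>l \<in> I\<close> by blast
  qed
  then show ?thesis
    using sub unfolding Q.brace_ideal_iff Q.subbrace_iff by blast
qed

lemma restrict_epi:
  assumes D: "subbrace D K" and E: "subbrace E Q" and "f ` D = E"
  shows "brace_epi (K\<lparr>carrier := D\<rparr>) (Q\<lparr>carrier := E\<rparr>) f"
proof -
  interpret D: skew_brace "K\<lparr>carrier := D\<rparr>" by (rule subbrace_restrict_is_skew_brace [OF D])
  interpret E: skew_brace "Q\<lparr>carrier := E\<rparr>" by (rule Q.subbrace_restrict_is_skew_brace [OF E])
  show ?thesis
    using assms subbrace_closed(1) [OF D] by unfold_locales (auto simp: hom_add hom_mult subset_iff)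
qed

end

text \<open>
  The quotient is built as the image of an operation-preserving map, so its axioms need only be
  transported, not rechecked on cosets.
\<close>

lemma (in skew_brace) image_is_epi:
  fixes Q :: "('c, 'd) ring_scheme"
  assumes surj: "f ` carrier B = carrier Q"
    and hom_add: "\<And>x y. \<lbrakk>x \<in> carrier B; y \<in> carrier B\<rbrakk> \<Longrightarrow> f (x \<oplus> y) = f x \<oplus>\<^bsub>Q\<^esub> f y"
    and hom_mult: "\<And>x y. \<lbrakk>x \<in> carrier B; y \<in> carrier B\<rbrakk> \<Longrightarrow> f (x \<otimes> y) = f x \<otimes>\<^bsub>Q\<^esub> f y"
    and zero: "\<zero>\<^bsub>Q\<^esub> = f \<zero>" and one: "\<one>\<^bsub>Q\<^esub> = f \<zero>"
  shows "brace_epi B Q f"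
proof -
  have lift: "\<exists>x\<in>carrier B. f x = q" if "q \<in> carrier Q" for q
    using that by (metis surj imageE)
  have "f \<in> hom (add_monoid B) (add_monoid Q)" "f \<in> hom B Q"
    using surj by (auto simp: hom_def hom_add hom_mult)
  from additive_group this(1) multiplicative_group this(2)
  have "Group.group ((add_monoid Q)\<lparr>carrier := f ` carrier B, one := f \<zero>\<rparr>)"
    "Group.group (Q\<lparr>carrier := f ` carrier B, one := f \<one>\<rparr>)"
    using group.hom_imp_img_group by fastforce+
  then have A: "Group.group (add_monoid Q)" and M: "Group.group Q"
    by (simp_all add: surj zero [symmetric]) (simp add: one_eq_zero one [symmetric])
  interpret A: Group.group "add_monoid Q"
    rewrites "carrier (add_monoid Q) = carrier Q"
    and "monoid.mult (add_monoid Q) = add Q"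
    and "monoid.one (add_monoid Q) = zero Q"
    and "m_inv (add_monoid Q) = a_inv Q"
    by (rule A) (auto simp: a_inv_def)
  have closed: "f x \<in> carrier Q" if "x \<in> carrier B" for x
    using that surj by blast
  have minus: "f (\<ominus> x) = \<ominus>\<^bsub>Q\<^esub> f x" if "x \<in> carrier B" for x
  proof -
    have "f (\<ominus> x) \<oplus>\<^bsub>Q\<^esub> f x = \<zero>\<^bsub>Q\<^esub>" using that zero by (simp add: hom_add [symmetric])
    then show ?thesis using A.inv_equality that closed by fastforce
  qed
  have "skew_brace Q"
  proof (rule skew_brace.intro [OF A M])
    fix p q r assume "p \<in> carrier Q" "q \<in> carrier Q" "r \<in> carrier Q"
    then obtain a b c where "a \<in> carrier B" "b \<in> carrier B" "c \<in> carrier B" "p = f a" "q = f b" "r = f c"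
      using lift by metis
    then show "p \<otimes>\<^bsub>Q\<^esub> (q \<oplus>\<^bsub>Q\<^esub> r) = p \<otimes>\<^bsub>Q\<^esub> q \<oplus>\<^bsub>Q\<^esub> \<ominus>\<^bsub>Q\<^esub> p \<oplus>\<^bsub>Q\<^esub> p \<otimes>\<^bsub>Q\<^esub> r"
      by (simp add: hom_add [symmetric] hom_mult [symmetric] minus [symmetric] brace_distrib)
  qed
  then show ?thesis
    using surj hom_add hom_mult skew_brace_axioms by (simp add: brace_epi_def brace_epi_axioms_def)
qed

text \<open>
  Additive and multiplicative cosets of an ideal coincide: \<open>w \<otimes> I = w \<oplus> lam w ` I = w \<oplus> I\<close>, and
  \<open>I\<close> is normal for both operations.
\<close>

lemma (in skew_brace) ideal_coset_iff:
  assumes I: "brace_ideal I B" and w: "w \<in> carrier B"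
  shows "x \<in> I +> w \<longleftrightarrow> (\<exists>m\<in>I. x = m \<otimes> w)"
proof -
  have A: "I \<lhd> add_monoid B" and M: "I \<lhd> B" and car: "I \<subseteq> carrier B"
    using I by (auto simp: brace_ideal_def subbrace_def subgroup_def)
  have conj: "\<forall>x\<in>carrier B. \<forall>i\<in>I. (\<exists>j\<in>I. x \<oplus> i = j \<oplus> x) \<and> (\<exists>j\<in>I. x \<otimes> i = j \<otimes> x)"
    using I by (simp add: brace_ideal_iff)
  have "\<exists>m\<in>I. i \<oplus> w = m \<otimes> w" if i: "i \<in> I" for i
  proof -
    have i': "i \<in> carrier B" using i car by auto
    have c: "\<ominus> w \<oplus> i \<oplus> w \<in> I"
      using normal.inv_op_closed1 [OF A, of w i] w i by (simp add: a_inv_def)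
    then have l: "lam (inv w) (\<ominus> w \<oplus> i \<oplus> w) \<in> I" using ideal_lam_closed [OF I] w by simp
    have "i \<oplus> w = w \<oplus> (\<ominus> w \<oplus> i \<oplus> w)" using w i' by (simp add: add.m_assoc [symmetric])
    also have "\<dots> = w \<otimes> lam (inv w) (\<ominus> w \<oplus> i \<oplus> w)" using w i' add_eq_mult_lam_inv by simp
    finally show ?thesis using conj w l by metis
  qed
  moreover have "\<exists>i\<in>I. m \<otimes> w = i \<oplus> w" if m: "m \<in> I" for m
  proof -
    have m': "m \<in> carrier B" using m car by auto
    have c: "inv w \<otimes> m \<otimes> w \<in> I"
      using normal.inv_op_closed1 [OF M, of w m] w m by simp
    then have l: "lam w (inv w \<otimes> m \<otimes> w) \<in> I" using ideal_lam_closed [OF I] w by simp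
    have "m \<otimes> w = w \<otimes> (inv w \<otimes> m \<otimes> w)" using w m' by (simp add: m_assoc [symmetric])
    also have "\<dots> = w \<oplus> lam w (inv w \<otimes> m \<otimes> w)" using w m' by (simp add: mult_eq_add_lam)
    finally show ?thesis using conj w l by metis
  qed
  ultimately show ?thesis by (auto simp: a_r_coset_def')
qed

lemma (in skew_brace) quotient_epi:
  assumes I: "brace_ideal I B"
  shows "brace_epi B (B Quot I) ((+>) I)"
proof (rule image_is_epi)
  have A: "I \<lhd> add_monoid B" and subA: "subgroup I (add_monoid B)" and car: "I \<subseteq> carrier B"
    using I by (auto simp: brace_ideal_def subbrace_def subgroup_def)
  show "(+>) I ` carrier B = carrier (B Quot I)"
    by (auto simp: FactRing_def A_RCOSETS_defs a_r_coset_defs)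
  show "I +> (x \<oplus> y) = (I +> x) \<oplus>\<^bsub>B Quot I\<^esub> (I +> y)" if "x \<in> carrier B" "y \<in> carrier B" for x y
    using normal.rcos_sum [OF A, of x y] that by (simp add: FactRing_def set_add_def a_r_coset_def)
  show "I +> (x \<otimes> y) = (I +> x) \<otimes>\<^bsub>B Quot I\<^esub> (I +> y)" if x: "x \<in> carrier B" and y: "y \<in> carrier B" for x y
  proof -
    have eq: "I +> (a \<otimes> b) = I +> (x \<otimes> y)" if a: "a \<in> I +> x" and b: "b \<in> I +> y" for a b
    proof -
      obtain i j where i: "i \<in> I" "a = i \<otimes> x" and j: "j \<in> I" "b = j \<otimes> y"
        using a b x y by (auto simp: ideal_coset_iff [OF I])
      obtain k where k: "k \<in> I" "x \<otimes> j = k \<otimes> x"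
        using I x j unfolding brace_ideal_iff by meson
      have [simp]: "i \<in> carrier B" "j \<in> carrier B" "k \<in> carrier B" using i j k car by auto
      have "a \<otimes> b = i \<otimes> ((x \<otimes> j) \<otimes> y)" using x y i j by (simp add: m_assoc)
      also have "\<dots> = (i \<otimes> k) \<otimes> (x \<otimes> y)" unfolding k using x y by (simp add: m_assoc)
      finally have "a \<otimes> b \<in> I +> (x \<otimes> y)"
        using x y i k subbrace_closed(4) [OF ideal_imp_subbrace [OF I]] by (auto simp: ideal_coset_iff [OF I])
      then show ?thesis
        using add.repr_independence [OF _ _ subA, of "a \<otimes> b" "x \<otimes> y"] x y by (simp add: a_r_coset_def)
    qed
    have "x \<in> I +> x" "y \<in> I +> y"
      using add.rcos_self subA x y by (simp_all add: a_r_coset_def)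
    with eq have "(\<Union>a\<in>I +> x. \<Union>b\<in>I +> y. I +> (a \<otimes> b)) = I +> (x \<otimes> y)"
      by blast
    then show ?thesis
      by (simp add: FactRing_def rcoset_mult_def)
  qed
  show "\<zero>\<^bsub>B Quot I\<^esub> = I +> \<zero>" "\<one>\<^bsub>B Quot I\<^esub> = I +> \<zero>"
    using add.coset_join2 [OF _ subA, of \<zero>] I
    by (simp_all add: FactRing_def one_eq_zero a_r_coset_def brace_ideal_iff)
qed

lemma (in skew_brace) quotient_kernel:
  assumes I: "brace_ideal I B" and a: "a \<in> carrier B"
  shows "I +> a = \<zero>\<^bsub>B Quot I\<^esub> \<longleftrightarrow> a \<in> I"
proof -
  have subA: "subgroup I (add_monoid B)" 
    using I by (auto simp: brace_ideal_def subbrace_def)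
  show ?thesis
    using add.coset_join1 [OF _ _ subA, of a] add.coset_join2 [OF _ subA, of a] a
    by (auto simp: FactRing_def a_r_coset_def)
qed

section \<open>Socle and centre\<close>

context skew_brace
begin

lemma mem_socle_iff:
  "a \<in> socle B \<longleftrightarrow> a \<in> carrier B \<and> (\<forall>b\<in>carrier B. a \<otimes> b = a \<oplus> b \<and> a \<oplus> b = b \<oplus> a)"
proof -
  have "lambda_map B a = (\<lambda>b\<in>carrier B. b) \<longleftrightarrow> (\<forall>b\<in>carrier B. a \<otimes> b = a \<oplus> b)"
    if a: "a \<in> carrier B"
  proof
    assume "lambda_map B a = (\<lambda>b\<in>carrier B. b)"
    then have "lam a b = b" if "b \<in> carrier B" for b
      using that lambda_map_eq_lam [of b a] by simp
    then show "\<forall>b\<in>carrier B. a \<otimes> b = a \<oplus> b" using a by (simp add: mult_eq_add_lam)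
  next
    assume "\<forall>b\<in>carrier B. a \<otimes> b = a \<oplus> b"
    then show "lambda_map B a = (\<lambda>b\<in>carrier B. b)"
      using a by (auto simp: lambda_map_def add.m_assoc [symmetric])
  qed
  then show ?thesis
    by (auto simp: socle_def kernel_def AutoGroup_def BijGroup_def group_center_def)
qed

lemma mem_center_iff:
  "a \<in> brace_center B \<longleftrightarrow>
    a \<in> carrier B \<and> (\<forall>b\<in>carrier B. a \<otimes> b = a \<oplus> b \<and> a \<oplus> b = b \<oplus> a \<and> b \<otimes> a = b \<oplus> a)"
  unfolding brace_center_def group_center_def Int_iff mem_Collect_eq mem_socle_iff by metis

lemma socle_closed: "a \<in> socle B \<Longrightarrow> a \<in> carrier B"
  using mem_socle_iff by blast

lemma socle_mult: "\<lbrakk>a \<in> socle B; b \<in> carrier B\<rbrakk> \<Longrightarrow> a \<otimes> b = a \<oplus> b"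
  using mem_socle_iff by blast

lemma socle_comm: "\<lbrakk>a \<in> socle B; b \<in> carrier B\<rbrakk> \<Longrightarrow> a \<oplus> b = b \<oplus> a"
  using mem_socle_iff by blast

lemma socle_lam:
  assumes a: "a \<in> socle B" and b: "b \<in> carrier B"
  shows "lam a b = b"
  using a b socle_closed by (intro lam_eqI) (simp_all add: socle_mult)

text \<open>
  Expanding \<open>b \<otimes> (a \<oplus> inv b)\<close> by the brace law shows that conjugation by \<open>b\<close> is \<open>lam b\<close> on the
  socle. This makes the socle a module for the multiplicative group.
\<close>

lemma socle_conj_eq_lam:
  assumes a: "a \<in> socle B" and b: "b \<in> carrier B"
  shows "b \<otimes> a = lam b a \<otimes> b" "lam b a \<in> socle B"
proof -
  have a': "a \<in> carrier B" using a by (rule socle_closed)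
  have central: "c \<oplus> lam b a = lam b a \<oplus> c" if c: "c \<in> carrier B" for c
  proof -
    have "lam b (lam (inv b) c \<oplus> a) = lam b (a \<oplus> lam (inv b) c)"
      using socle_comm [of a "lam (inv b) c"] a b c by simp
    then show ?thesis using a' b c by (simp add: lam_add lam_lam_inv)
  qed
  have "b \<otimes> a \<otimes> inv b = b \<otimes> (a \<oplus> inv b)"
    using a a' b by (simp add: m_assoc socle_mult)
  also have "\<dots> = b \<otimes> a \<oplus> \<ominus> b \<oplus> b \<otimes> inv b"
    using a' b by (intro brace_distrib) auto
  also have "\<dots> = b \<oplus> lam b a \<oplus> \<ominus> b"
    using a' b by (simp add: one_eq_zero mult_eq_add_lam [of b a])
  also have "\<dots> = lam b a"
    using a' b by (simp add: central add.m_assoc)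
  finally have conj: "b \<otimes> a \<otimes> inv b = lam b a" .
  have "b \<otimes> a = (b \<otimes> a \<otimes> inv b) \<otimes> b" using a' b by (simp add: m_assoc)
  then show "b \<otimes> a = lam b a \<otimes> b" using conj by simp
  have "lam (lam b a) c = c" if c: "c \<in> carrier B" for c
    unfolding conj [symmetric] using a a' b c by (simp add: lam_mult lam_lam_inv socle_lam)
  then show "lam b a \<in> socle B"
    using a' b central by (simp add: mem_socle_iff mult_eq_add_lam [of "lam b a"])
qed

text \<open>
  Submodules of the socle are ideals: they are additively central, and conjugation on them is the
  lambda map.
\<close>

lemma socle_left_ideal_is_ideal:
  assumes soc: "P \<subseteq> socle B" and zero: "\<zero> \<in> P"
    and add: "\<And>a b. \<lbrakk>a \<in> P; b \<in> P\<rbrakk> \<Longrightarrow> a \<oplus> b \<in> P" and minus: "\<And>a. a \<in> P \<Longrightarrow> \<ominus> a \<in> P"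
    and lam: "\<And>x a. \<lbrakk>x \<in> carrier B; a \<in> P\<rbrakk> \<Longrightarrow> lam x a \<in> P"
  shows "brace_ideal P B"
proof -
  have car: "P \<subseteq> carrier B" using soc socle_closed by auto
  have "(\<exists>j\<in>P. x \<oplus> i = j \<oplus> x) \<and> (\<exists>j\<in>P. x \<otimes> i = x \<oplus> j) \<and> (\<exists>j\<in>P. x \<otimes> i = j \<otimes> x)"
    if x: "x \<in> carrier B" and i: "i \<in> P" for x i
  proof (intro conjI)
    have i': "i \<in> socle B" "i \<in> carrier B" using i soc car by auto
    show "\<exists>j\<in>P. x \<oplus> i = j \<oplus> x" using i i' x socle_comm by metis
    show "\<exists>j\<in>P. x \<otimes> i = x \<oplus> j" using x i i' lam mult_eq_add_lam by blast
    show "\<exists>j\<in>P. x \<otimes> i = j \<otimes> x" using x i i' lam socle_conj_eq_lam(1) by blast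
  qed
  moreover have "\<exists>b\<in>P. a \<oplus> b = \<zero>" if "a \<in> P" for a
    using that minus car by (intro bexI [of _ "\<ominus> a"]) auto
  ultimately show ?thesis using car zero add unfolding brace_ideal_iff by blast
qed

lemma socle_zero: "\<zero> \<in> socle B"
  by (simp add: mem_socle_iff)

lemma socle_add:
  assumes a: "a \<in> socle B" and b: "b \<in> socle B" shows "a \<oplus> b \<in> socle B"
proof -
  have car: "a \<in> carrier B" "b \<in> carrier B" using a b by (auto intro: socle_closed)
  have ab: "a \<oplus> b = a \<otimes> b" using a car by (simp add: socle_mult)
  have "(a \<oplus> b) \<otimes> c = (a \<oplus> b) \<oplus> c" if "c \<in> carrier B" for c
    using a b car that by (simp add: ab m_assoc) (simp add: socle_mult add.m_assoc)
  moreover have "(a \<oplus> b) \<oplus> c = c \<oplus> (a \<oplus> b)" if c: "c \<in> carrier B" for c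
  proof -
    have "a \<oplus> (b \<oplus> c) = a \<oplus> (c \<oplus> b)" using socle_comm [of b c] b c by simp
    also have "\<dots> = c \<oplus> a \<oplus> b" using socle_comm [of a c] a car c by (simp add: add.m_assoc [symmetric])
    finally show ?thesis using car c by (simp add: add.m_assoc)
  qed
  ultimately show ?thesis using car by (simp add: mem_socle_iff)
qed

lemma socle_minus:
  assumes a: "a \<in> socle B" shows "\<ominus> a \<in> socle B" "\<ominus> a = inv a"
proof -
  have car: "a \<in> carrier B" using a by (rule socle_closed)
  have "a \<otimes> \<ominus> a = \<zero>" using a car by (simp add: socle_mult)
  then show eq: "\<ominus> a = inv a" using car by (intro eq_invI) auto
  have "lam (\<ominus> a) c = c" if c: "c \<in> carrier B" for c
  proof -
    have "lam (inv a) (lam a c) = c" using car c by (simp add: lam_lam_inv)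
    then show ?thesis using a c by (simp add: eq socle_lam)
  qed
  moreover have "\<ominus> a \<oplus> c = c \<oplus> \<ominus> a" if c: "c \<in> carrier B" for c
  proof -
    have "\<ominus> a \<oplus> c = \<ominus> a \<oplus> (c \<oplus> a) \<oplus> \<ominus> a"
      using car c by (simp add: add.m_assoc)
    also have "\<dots> = \<ominus> a \<oplus> (a \<oplus> c) \<oplus> \<ominus> a"
      using socle_comm [OF a c] by simp
    also have "\<dots> = c \<oplus> \<ominus> a" using car c by (simp add: add.m_assoc [symmetric])
    finally show ?thesis .
  qed
  ultimately show "\<ominus> a \<in> socle B" using car by (simp add: mem_socle_iff mult_eq_add_lam)
qed

lemma socle_ideal: "brace_ideal (socle B) B"
  using socle_zero socle_add socle_minus socle_conj_eq_lam(2)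
  by (intro socle_left_ideal_is_ideal) auto

lemma center_iff_socle_fixed:
  "a \<in> brace_center B \<longleftrightarrow> a \<in> socle B \<and> (\<forall>b\<in>carrier B. lam b a = a)"
proof -
  have "b \<otimes> a = b \<oplus> a \<longleftrightarrow> lam b a = a" if "a \<in> carrier B" "b \<in> carrier B" for b
    using that by (simp add: mult_eq_add_lam)
  then show ?thesis by (auto simp: mem_center_iff mem_socle_iff)
qed

lemma center_ideal: "brace_ideal (brace_center B) B"
proof (rule socle_left_ideal_is_ideal)
  have car: "\<And>a. a \<in> socle B \<Longrightarrow> a \<in> carrier B" by (rule socle_closed)
  show "brace_center B \<subseteq> socle B" by (auto simp: center_iff_socle_fixed)
  show "\<zero> \<in> brace_center B" by (simp add: center_iff_socle_fixed socle_zero)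
  show "a \<oplus> b \<in> brace_center B" if "a \<in> brace_center B" "b \<in> brace_center B" for a b
    using that car by (simp add: center_iff_socle_fixed socle_add lam_add)
  show "\<ominus> a \<in> brace_center B" if "a \<in> brace_center B" for a
    using that car by (simp add: center_iff_socle_fixed socle_minus(1) lam_minus)
  show "lam x a \<in> brace_center B" if "x \<in> carrier B" "a \<in> brace_center B" for x a
    using that by (simp add: center_iff_socle_fixed)
qed

end

section \<open>The upper central series above a given ideal\<close>

text \<open>
  The preimage in \<open>B\<close> of the centre of \<open>B / S\<close>: an element is central precisely when all of
  \<open>a \<otimes> b\<close>, \<open>a \<oplus> b\<close>, \<open>b \<oplus> a\<close>, \<open>b \<otimes> a\<close> agree. Speaking of cosets instead of a quotient keeps
  the type fixed, so that the operation can be iterated, and makes it visibly monotone in \<open>S\<close>.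
\<close>

definition rel_center :: "('a, 'b) ring_scheme \<Rightarrow> 'a set \<Rightarrow> 'a set"
  where "rel_center B S = {a \<in> carrier B. \<forall>b\<in>carrier B.
    a \<otimes>\<^bsub>B\<^esub> b \<in> S +>\<^bsub>B\<^esub> (a \<oplus>\<^bsub>B\<^esub> b) \<and> a \<oplus>\<^bsub>B\<^esub> b \<in> S +>\<^bsub>B\<^esub> (b \<oplus>\<^bsub>B\<^esub> a) \<and> b \<otimes>\<^bsub>B\<^esub> a \<in> S +>\<^bsub>B\<^esub> (b \<oplus>\<^bsub>B\<^esub> a)}"

text \<open>
  For an ideal \<open>S\<close> this says that \<open>B / S\<close> is centrally nilpotent. The number of steps may be \<open>0\<close>,
  which makes \<open>nilpotent_over B (carrier B)\<close> hold trivially.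
\<close>

definition nilpotent_over :: "('a, 'b) ring_scheme \<Rightarrow> 'a set \<Rightarrow> bool"
  where "nilpotent_over B S \<longleftrightarrow> (\<exists>n. (rel_center B ^^ n) S = carrier B)"

lemma rel_center_subset: "rel_center B S \<subseteq> carrier B"
  by (auto simp: rel_center_def)

lemma rel_center_mono:
  assumes "S \<subseteq> T" shows "rel_center B S \<subseteq> rel_center B T"
proof -
  have "S +>\<^bsub>B\<^esub> x \<subseteq> T +>\<^bsub>B\<^esub> x" for x
    using assms by (auto simp: a_r_coset_def')
  then show ?thesis unfolding rel_center_def by blast
qed

lemma rel_center_iterate_mono: "S \<subseteq> T \<Longrightarrow> (rel_center B ^^ n) S \<subseteq> (rel_center B ^^ n) T"
  by (induction n) (simp_all add: rel_center_mono)

lemma rel_center_iterate_subset: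
  "S \<subseteq> carrier B \<Longrightarrow> (rel_center B ^^ n) S \<subseteq> carrier B"
  by (cases n) (simp_all add: rel_center_subset)

lemma nilpotent_over_mono:
  assumes "nilpotent_over B S" "S \<subseteq> T" "T \<subseteq> carrier B"
  shows "nilpotent_over B T"
proof -
  obtain n where "(rel_center B ^^ n) S = carrier B" using assms(1) by (auto simp: nilpotent_over_def)
  then have "(rel_center B ^^ n) T = carrier B"
    using rel_center_iterate_mono [OF assms(2), where n = n and B = B] rel_center_iterate_subset [OF assms(3), where n = n] by auto
  then show ?thesis by (auto simp: nilpotent_over_def)
qed

lemma (in brace_epi) pull_rel_center:
  assumes S: "S \<subseteq> carrier Q"
  shows "pull (rel_center Q S) = rel_center K (pull S)"
proof -
  have "f a \<in> rel_center Q S \<longleftrightarrow> a \<in> rel_center K (pull S)" if a: "a \<in> carrier K" for a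
  proof -
    have "f a \<in> rel_center Q S \<longleftrightarrow> (\<forall>b\<in>carrier K. f a \<otimes>\<^bsub>Q\<^esub> f b \<in> S +>\<^bsub>Q\<^esub> (f a \<oplus>\<^bsub>Q\<^esub> f b) \<and>
      f a \<oplus>\<^bsub>Q\<^esub> f b \<in> S +>\<^bsub>Q\<^esub> (f b \<oplus>\<^bsub>Q\<^esub> f a) \<and> f b \<otimes>\<^bsub>Q\<^esub> f a \<in> S +>\<^bsub>Q\<^esub> (f b \<oplus>\<^bsub>Q\<^esub> f a))"
      using a by (simp add: rel_center_def surj [symmetric])
    then show ?thesis
      using a S by (simp add: rel_center_def mem_coset_pull_iff hom_add hom_mult)
  qed
  then show ?thesis using rel_center_subset [of K "pull S"] by (auto simp: pull_def)
qed

lemma (in brace_epi) pull_rel_center_iterate: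
  assumes S: "S \<subseteq> carrier Q"
  shows "pull ((rel_center Q ^^ n) S) = (rel_center K ^^ n) (pull S)"
  by (induction n) (simp_all add: pull_rel_center rel_center_iterate_subset S)

lemma (in brace_epi) nilpotent_over_pull_iff:
  assumes S: "S \<subseteq> carrier Q"
  shows "nilpotent_over K (pull S) \<longleftrightarrow> nilpotent_over Q S"
proof -
  have "(rel_center K ^^ n) (pull S) = carrier K \<longleftrightarrow> (rel_center Q ^^ n) S = carrier Q" for n
    using image_pull [OF rel_center_iterate_subset [OF S, where n = n]] surj
    by (auto simp: pull_rel_center_iterate [OF S, symmetric])
  then show ?thesis by (simp add: nilpotent_over_def)
qed

context skew_brace
begin

lemma rel_center_zero: "rel_center B {\<zero>} = brace_center B"
proof -
  have coset: "{\<zero>} +> y = {y}" if "y \<in> carrier B" for y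
    using that by (simp add: a_r_coset_def')
  have "a \<in> rel_center B {\<zero>} \<longleftrightarrow> a \<in> brace_center B" if "a \<in> carrier B" for a
    unfolding mem_center_iff using that by (simp add: rel_center_def coset cong: ball_cong)
  moreover have "brace_center B \<subseteq> carrier B" using mem_center_iff by blast
  ultimately show ?thesis using rel_center_subset [of B "{\<zero>}"] by blast
qed

lemma rel_center_eq_quotient:
  assumes I: "brace_ideal I B"
  shows "rel_center B I = {a \<in> carrier B. I +> a \<in> brace_center (B Quot I)}"
proof -
  interpret q: brace_epi B "B Quot I" "(+>) I" by (rule quotient_epi [OF I])
  have "q.pull {\<zero>\<^bsub>B Quot I\<^esub>} = I"
    using I quotient_kernel [OF I] by (auto simp: q.pull_def brace_ideal_iff)
  then show ?thesis
    using q.pull_rel_center [of "{\<zero>\<^bsub>B Quot I\<^esub>}"] by (simp add: q.Q.rel_center_zero q.pull_def)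
qed

lemma rel_center_ideal:
  assumes I: "brace_ideal I B" shows "brace_ideal (rel_center B I) B"
proof -
  interpret q: brace_epi B "B Quot I" "(+>) I" by (rule quotient_epi [OF I])
  show ?thesis
    using q.ideal_pull [OF q.Q.center_ideal] by (simp add: rel_center_eq_quotient [OF I] q.pull_def)
qed

lemma zero_ideal: "brace_ideal {\<zero>} B"
  by (simp add: brace_ideal_iff)

lemma rel_center_iterate_ideal:
  "brace_ideal I B \<Longrightarrow> brace_ideal ((rel_center B ^^ n) I) B"
  by (induction n) (simp_all add: rel_center_ideal)

lemma ideal_subset_rel_center:
  assumes I: "brace_ideal I B" shows "I \<subseteq> rel_center B I"
proof -
  interpret q: brace_epi B "B Quot I" "(+>) I" by (rule quotient_epi [OF I])
  have "a \<in> carrier B" "I +> a = \<zero>\<^bsub>B Quot I\<^esub>" if "a \<in> I" for a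
    using that I quotient_kernel [OF I] by (auto simp: brace_ideal_iff)
  then show ?thesis
    using q.Q.center_ideal unfolding q.Q.brace_ideal_iff by (auto simp: rel_center_eq_quotient [OF I])
qed

lemma center_series_eq_iterate: "center_series B (Suc n) = (rel_center B ^^ Suc n) {\<zero>}"
proof (induction n)
  case 0
  show ?case by (simp add: rel_center_zero)
next
  case (Suc n)
  have "rel_center B (center_series B (Suc n)) = center_series B (Suc (Suc n))"
    unfolding Suc.IH center_series.simps(3)
    by (rule rel_center_eq_quotient [OF rel_center_iterate_ideal [OF zero_ideal]])
  then show ?case by (simp only: Suc.IH) simp
qed

lemma centrally_nilpotent_iff: "centrally_nilpotent B \<longleftrightarrow> nilpotent_over B {\<zero>}"
proof
  assume "centrally_nilpotent B"
  then obtain n where "n \<ge> 1" "center_series B n = carrier B" by (auto simp: centrally_nilpotent_def)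
  then show "nilpotent_over B {\<zero>}"
    using center_series_eq_iterate [of "n - 1"] by (auto simp: nilpotent_over_def)
next
  assume "nilpotent_over B {\<zero>}"
  then obtain n where n: "(rel_center B ^^ n) {\<zero>} = carrier B" by (auto simp: nilpotent_over_def)
  have "(rel_center B ^^ n) {\<zero>} \<subseteq> (rel_center B ^^ Suc n) {\<zero>}"
    using ideal_subset_rel_center [OF rel_center_iterate_ideal [OF zero_ideal]] by simp
  then have "center_series B (Suc n) = carrier B"
    using n rel_center_subset [of B] unfolding center_series_eq_iterate by auto
  then show "centrally_nilpotent B" by (auto simp: centrally_nilpotent_def)
qed

lemma socle_series_ideal: "brace_ideal (socle_series B n) B"
proof (induction n)
  case 0
  show ?case by (simp add: zero_ideal)
next
  case (Suc n)
  let ?S = "socle_series B n"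
  interpret q: brace_epi B "B Quot ?S" "(+>) ?S"
    by (rule quotient_epi [OF Suc.IH])
  have "brace_ideal {a \<in> carrier B. ?S +> a \<in> socle (B Quot ?S)} B"
    using q.ideal_pull [OF q.Q.socle_ideal] unfolding q.pull_def .
  then show ?case by (cases n) (simp_all add: socle_ideal)
qed

end

section \<open>A supplement of a minimal ideal\<close>

context skew_brace
begin

text \<open>
  Four readings of the same fact, that \<open>z\<close> is central modulo \<open>J\<close>, as exact equations with an error
  term in \<open>J\<close>. They are what allows one to argue with elements that are central only modulo \<open>J\<close>
  whenever \<open>J\<close> acts trivially.
\<close>

lemma rel_center_moves:
  assumes J: "brace_ideal J B" and z: "z \<in> rel_center B J" and k: "k \<in> carrier B"
  shows "\<exists>j\<in>J. z \<otimes> k = j \<otimes> (k \<otimes> z)" "\<exists>j\<in>J. lam k z = j \<oplus> z"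
    "\<exists>j\<in>J. lam z k = j \<oplus> k" "\<exists>j\<in>J. k \<oplus> z = j \<oplus> (z \<oplus> k)"
proof -
  interpret q: brace_epi B "B Quot J" "(+>) J" by (rule quotient_epi [OF J])
  have subA: "subgroup J (add_monoid B)" using J by (simp add: brace_ideal_def subbrace_def)
  have z': "z \<in> carrier B" and c: "J +> z \<in> brace_center (B Quot J)"
    using z by (simp_all add: rel_center_eq_quotient [OF J])
  have *: "x \<in> J +> y" if "x \<in> carrier B" "J +> x = J +> y" for x y
    using add.repr_independenceD [OF subA that(1), of y] that(2) by (simp add: a_r_coset_def)
  have cs: "J +> z \<in> socle (B Quot J)"
    using c by (simp add: q.Q.center_iff_socle_fixed)
  let ?z = "J +> z" and ?k = "J +> k"
  have "?z \<otimes>\<^bsub>B Quot J\<^esub> ?k = ?k \<otimes>\<^bsub>B Quot J\<^esub> ?z"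
    using c k q.hom_closed by (metis q.Q.mem_center_iff)
  then have "z \<otimes> k \<in> J +> (k \<otimes> z)" using z' k by (intro *) (simp_all add: q.hom_mult)
  then show "\<exists>j\<in>J. z \<otimes> k = j \<otimes> (k \<otimes> z)" using ideal_coset_iff [OF J] z' k by simp
  have "lam k z \<in> J +> z" 
    using c z' k by (intro *) (simp_all add: q.hom_lam q.Q.center_iff_socle_fixed)
  then show "\<exists>j\<in>J. lam k z = j \<oplus> z" by (auto simp: a_r_coset_def')
  have "lam z k \<in> J +> k" 
    using cs z' k by (intro *) (simp_all add: q.hom_lam q.Q.socle_lam)
  then show "\<exists>j\<in>J. lam z k = j \<oplus> k" by (auto simp: a_r_coset_def')
  have "?k \<oplus>\<^bsub>B Quot J\<^esub> ?z = ?z \<oplus>\<^bsub>B Quot J\<^esub> ?k"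
    using cs k q.Q.socle_comm by simp
  then have "k \<oplus> z \<in> J +> (z \<oplus> k)" using z' k by (intro *) (simp_all add: q.hom_add)
  then show "\<exists>j\<in>J. k \<oplus> z = j \<oplus> (z \<oplus> k)" by (auto simp: a_r_coset_def')
qed

text \<open>
  Since \<open>lam z\<close> commutes with the action, its fixed points in \<open>P\<close> form a submodule, hence an
  ideal; by minimality this is zero. So \<open>p \<mapsto> lam z p \<ominus> p\<close> is injective, hence
  onto, on the finite group \<open>P\<close>.
\<close>

lemma minimal_ideal_fixed_point_free:
  assumes fin: "finite (carrier B)" and P: "brace_ideal P B" and soc: "P \<subseteq> socle B"
    and minimal: "\<And>I. \<lbrakk>brace_ideal I B; I \<subseteq> P\<rbrakk> \<Longrightarrow> I = {\<zero>} \<or> I = P"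
    and z: "z \<in> carrier B"
    and comm: "\<And>k p. \<lbrakk>k \<in> carrier B; p \<in> P\<rbrakk> \<Longrightarrow> lam z (lam k p) = lam k (lam z p)"
    and moves: "\<exists>p\<in>P. lam z p \<noteq> p"
  shows "\<And>p. \<lbrakk>p \<in> P; lam z p = p\<rbrakk> \<Longrightarrow> p = \<zero>"
    and "\<And>u. u \<in> P \<Longrightarrow> \<exists>p\<in>P. lam z p = u \<oplus> p"
proof -
  have car: "p \<in> carrier B" if "p \<in> P" for p using that soc socle_closed by auto
  note closed = subbrace_closed [OF ideal_imp_subbrace [OF P]]
  have "brace_ideal {p \<in> P. lam z p = p} B"
    using soc closed(2,3,5) ideal_lam_closed [OF P] car z comm
    by (intro socle_left_ideal_is_ideal) (auto simp: lam_add lam_minus)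
  then have "{p \<in> P. lam z p = p} = {\<zero>} \<or> {p \<in> P. lam z p = p} = P"
    by (rule minimal) auto
  then show free: "p = \<zero>" if "p \<in> P" "lam z p = p" for p
    using that moves by blast
  fix u assume u: "u \<in> P"
  let ?g = "\<lambda>p. lam z p \<oplus> \<ominus> p"
  have inj: "inj_on ?g P"
  proof (rule inj_onI)
    fix p p' assume p: "p \<in> P" "p' \<in> P" and eq: "?g p = ?g p'"
    have [simp]: "p \<in> carrier B" "p' \<in> carrier B" using p car by auto
    have "lam z (\<ominus> p' \<oplus> p) = \<ominus> lam z p' \<oplus> (?g p \<oplus> p)"
      using z by (simp add: lam_add lam_minus add.m_assoc)
    also have "\<dots> = \<ominus> p' \<oplus> p"
      unfolding eq using z by (simp add: add.m_assoc [symmetric])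
    finally have "\<ominus> p' \<oplus> p = \<zero>"
      using p closed(3,5) by (intro free) auto
    then have "p' \<oplus> (\<ominus> p' \<oplus> p) = p'" by simp
    then show "p = p'" by (simp add: add.m_assoc [symmetric])
  qed
  have "?g ` P \<subseteq> P" using closed(3,5) ideal_lam_closed [OF P z] by auto
  moreover have "finite P" using fin car finite_subset [of P "carrier B"] by auto
  ultimately have "?g ` P = P" using inj endo_inj_surj by blast
  then have "u \<in> ?g ` P" using u by (simp only:)
  then obtain p where p: "p \<in> P" "u = lam z p \<oplus> \<ominus> p" by blast
  have "p \<in> carrier B" using p car by auto
  then have "lam z p = u \<oplus> p" using p(2) z by (simp add: add.m_assoc)
  then show "\<exists>p\<in>P. lam z p = u \<oplus> p" using p by blast
qed

text \<open>
  Let \<open>Y\<close> be the centre modulo \<open>P\<close>. If some \<open>z \<in> Y\<close> moves a point of \<open>P\<close>, the fixed points of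
  \<open>lam z\<close> are the desired supplement. Otherwise \<open>Y\<close> acts trivially on \<open>P\<close>, and this is impossible:
  take \<open>z\<close> in the first term of the upper central series above \<open>P\<close> that acts nontrivially on \<open>Y\<close>.
  All earlier terms act trivially on \<open>Y\<close>, so \<open>lam z\<close> commutes with the whole action on \<open>Y\<close>; it
  must move a point of \<open>P\<close>, as else \<open>y \<mapsto> lam z y \<ominus> y\<close> would map \<open>Y\<close> into the fixed points of \<open>P\<close>,
  which are central. Then every element of \<open>Y\<close> is an element of \<open>P\<close> plus a fixed point of
  \<open>lam z\<close>. Such a fixed point is central in \<open>B\<close>, thus zero, so that \<open>Y = P\<close>: the series never
  leaves \<open>P\<close>, although it reaches \<open>z\<close>.
\<close>

lemma minimal_ideal_supplement:
  assumes fin: "finite (carrier B)" and center: "brace_center B = {\<zero>}"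
    and P: "brace_ideal P B" "P \<noteq> {\<zero>}" and soc: "P \<subseteq> socle B"
    and minimal: "\<And>I. \<lbrakk>brace_ideal I B; I \<subseteq> P\<rbrakk> \<Longrightarrow> I = {\<zero>} \<or> I = P"
    and nil: "nilpotent_over B P"
  shows "\<exists>L. subbrace L B \<and> L \<noteq> carrier B \<and> (\<forall>x\<in>carrier B. \<exists>p\<in>P. \<exists>l\<in>L. x = p \<oplus> l)"
proof -
  note closed = subbrace_closed [OF ideal_imp_subbrace [OF P(1)]]
  have car: "p \<in> carrier B" if "p \<in> P" for p using that soc socle_closed by auto
  define Y where "Y = rel_center B P"
  have Yi: "brace_ideal Y B" unfolding Y_def by (rule rel_center_ideal [OF P(1)])
  have PY: "P \<subseteq> Y" unfolding Y_def by (rule ideal_subset_rel_center [OF P(1)])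
  have Ycar: "y \<in> carrier B" if "y \<in> Y" for y
    using that rel_center_subset [of B P] unfolding Y_def by blast
  note moves = rel_center_moves [OF P(1), folded Y_def]
  have no_fixed: "p = \<zero>" if "p \<in> P" "\<And>k. k \<in> carrier B \<Longrightarrow> lam k p = p" for p
  proof -
    have "p \<in> brace_center B" using that soc by (auto simp: center_iff_socle_fixed)
    then show ?thesis using center by simp
  qed
  \<comment> \<open>\<open>z \<otimes> k\<close> and \<open>k \<otimes> z\<close> differ by an element of the socle, which acts trivially.\<close>
  have Ycomm: "lam z (lam k x) = lam k (lam z x)" if z: "z \<in> Y" and k: "k \<in> carrier B" and x: "x \<in> carrier B" for z k x
  proof -
    obtain j where j: "j \<in> P" "z \<otimes> k = j \<otimes> (k \<otimes> z)" using moves(1) [OF z k] by blast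
    have "lam (z \<otimes> k) x = lam (k \<otimes> z) x"
      unfolding j(2) using j(1) soc car z Ycar k x by (simp add: lam_mult socle_lam subset_iff)
    then show ?thesis using z Ycar k x by (simp add: lam_mult)
  qed
  \<comment> \<open>If \<open>z\<close> moves \<open>x\<close> by an element of \<open>P\<close>, the bijection \<open>lam z - 1\<close> of \<open>P\<close> can absorb it.\<close>
  have adjust: "\<exists>p\<in>P. lam z (p \<oplus> x) = p \<oplus> x"
    if z: "z \<in> carrier B" and x: "x \<in> carrier B" and u: "u \<in> P" "lam z x = u \<oplus> x"
      and onto: "\<And>u. u \<in> P \<Longrightarrow> \<exists>p\<in>P. lam z p = u \<oplus> p" for z x u
  proof -
    obtain p where p: "p \<in> P" "lam z p = \<ominus> u \<oplus> p" using onto closed(5) u by blast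
    have [simp]: "p \<in> carrier B" "u \<in> carrier B" using p u car by auto
    have "lam z (p \<oplus> x) = p \<oplus> \<ominus> u \<oplus> (u \<oplus> x)"
      using z x u p socle_comm [of p "\<ominus> u"] soc by (auto simp: lam_add)
    also have "\<dots> = p \<oplus> (\<ominus> u \<oplus> u) \<oplus> x" using x by (simp only: add.m_assoc add.m_closed add.inv_closed \<open>p \<in> carrier B\<close> \<open>u \<in> carrier B\<close>)
    also have "\<dots> = p \<oplus> x" using x by simp
    finally show ?thesis using p by blast
  qed
  show ?thesis
  proof (cases "\<exists>z\<in>Y. \<exists>p\<in>P. lam z p \<noteq> p")
    case True
    then obtain z where z: "z \<in> Y" "\<exists>p\<in>P. lam z p \<noteq> p" by blast
    have z': "z \<in> carrier B" using z Ycar by auto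
    have onto: "\<And>u. u \<in> P \<Longrightarrow> \<exists>p\<in>P. lam z p = u \<oplus> p"
      using fin P(1) soc minimal z' Ycomm [OF z(1)] car z(2)
      by (intro minimal_ideal_fixed_point_free(2)) auto
    define L where "L = {x \<in> carrier B. lam z x = x}"
    have "subbrace L B"
      using z' Ycomm [OF z(1)] unfolding L_def
      by (intro left_ideal_imp_subbrace) (auto simp: lam_add lam_minus)
    moreover have "L \<noteq> carrier B" using z(2) car unfolding L_def by blast
    moreover have "\<exists>p\<in>P. \<exists>l\<in>L. x = p \<oplus> l" if x: "x \<in> carrier B" for x
    proof -
      obtain u where "u \<in> P" "lam z x = u \<oplus> x" using moves(3) [OF z(1) x] by blast
      then obtain p where p: "p \<in> P" "lam z (p \<oplus> x) = p \<oplus> x"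
        using adjust z' x onto by blast
      then have "p \<oplus> x \<in> L" "x = \<ominus> p \<oplus> (p \<oplus> x)" "\<ominus> p \<in> P"
        using car x closed(5) by (auto simp: L_def add.m_assoc [symmetric])
      then show ?thesis by blast
    qed
    ultimately show ?thesis by blast
  next
    case False
    then have Ytriv: "\<And>y p. \<lbrakk>y \<in> Y; p \<in> P\<rbrakk> \<Longrightarrow> lam y p = p" by blast
    define J where "J i = (rel_center B ^^ i) P" for i
    have J0: "J 0 = P" and JSuc: "\<And>i. J (Suc i) = rel_center B (J i)" by (simp_all add: J_def)
    have Ji: "brace_ideal (J i) B" for i unfolding J_def by (rule rel_center_iterate_ideal [OF P(1)])
    have Jcar: "k \<in> carrier B" if "k \<in> J i" for k i
      using that Ji [of i] by (auto simp: brace_ideal_iff)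
    obtain n where n: "J n = carrier B" using nil unfolding nilpotent_over_def J_def by blast
    define acts where "acts i \<longleftrightarrow> (\<exists>k\<in>J i. \<exists>y\<in>Y. lam k y \<noteq> y)" for i
    have "acts n"
    proof (rule ccontr)
      assume "\<not> acts n"
      then have "p = \<zero>" if "p \<in> P" for p
        using that PY n no_fixed unfolding acts_def by blast
      then show False using P(2) closed(2) by blast
    qed
    then have least: "acts (LEAST i. acts i)" by (rule LeastI)
    have "\<not> acts 0" using soc socle_lam Ycar unfolding acts_def J0 by blast
    then have "(LEAST i. acts i) \<noteq> 0" using least by metis
    then obtain m where m: "(LEAST i. acts i) = Suc m" using not0_implies_Suc by blast
    have "\<not> acts m" using not_less_Least [of m acts] m by simp
    then have Jm: "lam j y = y" if "j \<in> J m" "y \<in> Y" for j y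
      using that unfolding acts_def by blast
    obtain z y1 where z: "z \<in> J (Suc m)" and y1: "y1 \<in> Y" "lam z y1 \<noteq> y1"
      using least [unfolded m] unfolding acts_def by blast
    have z': "z \<in> carrier B" using z Jcar by blast
    have zcomm: "lam z (lam k y) = lam k (lam z y)" if k: "k \<in> carrier B" and y: "y \<in> Y" for k y
    proof -
      obtain j where j: "j \<in> J m" "z \<otimes> k = j \<otimes> (k \<otimes> z)"
        using rel_center_moves(1) [OF Ji z [unfolded JSuc] k] by blast
      have "lam (k \<otimes> z) y \<in> Y" using ideal_lam_closed [OF Yi] k z' y by simp
      then have "lam (z \<otimes> k) y = lam (k \<otimes> z) y"
        unfolding j(2) using j(1) Jm Jcar k z' y Ycar by (simp add: lam_mult [of j "k \<otimes> z" y])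
      then show ?thesis using y Ycar k z' by (simp add: lam_mult)
    qed
    have "\<exists>p\<in>P. lam z p \<noteq> p"
    proof (rule ccontr)
      assume "\<not> ?thesis"
      then have triv: "\<And>p. p \<in> P \<Longrightarrow> lam z p = p" by blast
      have y1': "y1 \<in> carrier B" using y1 Ycar by auto
      obtain d where d: "d \<in> P" "lam z y1 = d \<oplus> y1" using moves(2) [OF y1(1) z'] by blast
      have "lam k d = d" if k: "k \<in> carrier B" for k
      proof -
        obtain p where p: "p \<in> P" "lam k y1 = p \<oplus> y1" using moves(2) [OF y1(1) k] by blast
        have [simp]: "p \<in> carrier B" "d \<in> carrier B" using p d car by auto
        have "lam k d \<oplus> (p \<oplus> y1) = lam z (p \<oplus> y1)"
          using zcomm [OF k y1(1)] k y1' by (simp add: d p lam_add)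
        also have "\<dots> = d \<oplus> (p \<oplus> y1)"
          using z' y1' triv [OF p(1)] socle_comm [of p d] soc p
          by (auto simp: lam_add d add.m_assoc [symmetric])
        finally show ?thesis using k y1' by simp
      qed
      then have "d = \<zero>" using no_fixed d by blast
      then show False using y1 d y1' by simp
    qed
    then have free: "\<And>p. \<lbrakk>p \<in> P; lam z p = p\<rbrakk> \<Longrightarrow> p = \<zero>"
      and onto: "\<And>u. u \<in> P \<Longrightarrow> \<exists>p\<in>P. lam z p = u \<oplus> p"
      using minimal_ideal_fixed_point_free [OF fin P(1) soc minimal z'] zcomm PY by blast+
    have central: "y \<in> brace_center B" if y: "y \<in> Y" and fixed: "lam z y = y" for y
    proof -
      have [simp]: "y \<in> carrier B" using y Ycar by auto
      \<comment> \<open>\<open>lam k y \<ominus> y\<close> lies in \<open>P\<close> and is fixed by \<open>z\<close>, hence zero.\<close>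
      have all_fix: "lam k y = y" if k: "k \<in> carrier B" for k
      proof -
        obtain u where u: "u \<in> P" "lam k y = u \<oplus> y" using moves(2) [OF y k] by blast
        have "u \<in> carrier B" using u car by auto
        moreover have "lam z (u \<oplus> y) = u \<oplus> y" using zcomm [OF k y] by (simp add: fixed u)
        ultimately have "lam z u = u" using z' by (simp add: lam_add fixed)
        then have "u = \<zero>" using free u(1) by blast
        then show ?thesis using u by simp
      qed
      \<comment> \<open>Once earlier terms commute with \<open>y\<close>, the commutator of \<open>k\<close> and \<open>y\<close> is an element of \<open>P\<close>
        fixed by everything: applying \<open>lam x\<close> changes \<open>k\<close> only by an earlier term.\<close>
      have add_comm: "k \<oplus> y = y \<oplus> k" if "k \<in> J i" for k i
        using that
      proof (induction i arbitrary: k)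
        case 0
        then have "k \<in> socle B" using soc by (auto simp: J0)
        then show ?case by (simp add: socle_comm [of k y])
      next
        case (Suc i)
        have [simp]: "k \<in> carrier B" using Suc.prems Jcar by blast
        obtain c where c: "c \<in> P" "k \<oplus> y = c \<oplus> (y \<oplus> k)" using moves(4) [OF y, of k] by auto
        have [simp]: "c \<in> carrier B" using c car by auto
        have "lam x c = c" if x: "x \<in> carrier B" for x
        proof -
          obtain j where j: "j \<in> J i" "lam x k = j \<oplus> k"
            using rel_center_moves(2) [OF Ji Suc.prems [unfolded JSuc] x] by blast
          have [simp]: "j \<in> carrier B" using j Jcar by blast
          have "lam x c \<oplus> (y \<oplus> (j \<oplus> k)) = lam x (k \<oplus> y)"
            using x by (simp add: c lam_add all_fix j)
          also have "\<dots> = j \<oplus> (k \<oplus> y)" using x by (simp add: lam_add all_fix j add.m_assoc)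
          also have "\<dots> = (c \<oplus> j) \<oplus> (y \<oplus> k)"
            using socle_comm [of c j] soc c by (auto simp: add.m_assoc [symmetric])
          also have "\<dots> = c \<oplus> ((j \<oplus> y) \<oplus> k)" by (simp add: add.m_assoc)
          also have "\<dots> = c \<oplus> (y \<oplus> (j \<oplus> k))" unfolding Suc.IH [OF j(1)] by (simp add: add.m_assoc)
          finally show ?thesis using x by simp
        qed
        then have "c = \<zero>" using no_fixed c by blast
        then show ?case using c by simp
      qed
      \<comment> \<open>The same argument applies to \<open>lam y k \<ominus> k\<close>; its base case is the triviality of \<open>Y\<close> on \<open>P\<close>.\<close>
      have triv: "lam y k = k" if "k \<in> J i" for k i
        using that
      proof (induction i arbitrary: k)
        case 0
        then show ?case using Ytriv y by (simp add: J0)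
      next
        case (Suc i)
        have [simp]: "k \<in> carrier B" using Suc.prems Jcar by blast
        obtain d where d: "d \<in> P" "lam y k = d \<oplus> k" using moves(3) [OF y, of k] by auto
        have [simp]: "d \<in> carrier B" using d car by auto
        have "lam x d = d" if x: "x \<in> carrier B" for x
        proof -
          obtain j where j: "j \<in> J i" "lam x k = j \<oplus> k"
            using rel_center_moves(2) [OF Ji Suc.prems [unfolded JSuc] x] by blast
          have [simp]: "j \<in> carrier B" using j Jcar by blast
          have "lam x d \<oplus> (j \<oplus> k) = lam x (lam y k)" using x by (simp add: d lam_add j)
          also have "\<dots> = lam y (j \<oplus> k)" using Ycomm [OF y x, of k] by (simp add: j)
          also have "\<dots> = j \<oplus> (d \<oplus> k)" by (simp add: lam_add Suc.IH [OF j(1)] d)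
          also have "\<dots> = d \<oplus> (j \<oplus> k)"
            using socle_comm [of d j] soc d(1) by (auto simp: add.m_assoc [symmetric])
          finally show ?thesis using x by simp
        qed
        then have "d = \<zero>" using no_fixed d by blast
        then show ?case using d by simp
      qed
      have "y \<in> socle B"
        unfolding mem_socle_iff using add_comm [where i = n] triv [where i = n] n
        by (auto simp: mult_eq_add_lam)
      then show ?thesis using all_fix by (simp add: center_iff_socle_fixed)
    qed
    have "Y \<subseteq> P"
    proof
      fix y assume y: "y \<in> Y"
      then have y': "y \<in> carrier B" using Ycar by auto
      obtain u where "u \<in> P" "lam z y = u \<oplus> y" using moves(2) [OF y z'] by blast
      then obtain p where p: "p \<in> P" "lam z (p \<oplus> y) = p \<oplus> y"
        using adjust z' y' onto by blast
      moreover have "p \<oplus> y \<in> Y"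
        using p y PY subbrace_closed(3) [OF ideal_imp_subbrace [OF Yi]] by blast
      ultimately have "p \<oplus> y = \<zero>" using central center by blast
      then have "y = \<ominus> p" using p car y' eq_minusI by blast
      then show "y \<in> P" using p closed(5) by blast
    qed
    have "J i \<subseteq> P" for i
    proof (induction i)
      case 0
      show ?case by (simp add: J0)
    next
      case (Suc i)
      then show ?case using rel_center_mono [OF Suc.IH, of B] \<open>Y \<subseteq> P\<close> unfolding JSuc Y_def by blast
    qed
    then have "z \<in> socle B" using z soc by blast
    then show ?thesis using y1 Ycar socle_lam by blast
  qed
qed

end

section \<open>Restriction to subbraces\<close>

context skew_brace
begin

lemma carrier_subbrace: "subbrace (carrier B) B"
  unfolding subbrace_iff
proof (intro conjI ballI)
  fix a assume a: "a \<in> carrier B"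
  show "\<exists>b\<in>carrier B. a \<oplus> b = \<zero>" using a by (intro bexI [of _ "\<ominus> a"]) simp_all
  show "\<exists>b\<in>carrier B. a \<otimes> b = \<zero>" using a by (intro bexI [of _ "inv a"]) (simp_all add: one_eq_zero)
qed simp_all

lemma ideal_restrict:
  assumes I: "brace_ideal I B" and C: "subbrace C B"
  shows "brace_ideal (I \<inter> C) (B\<lparr>carrier := C\<rparr>)"
proof -
  interpret C: skew_brace "B\<lparr>carrier := C\<rparr>" by (rule subbrace_restrict_is_skew_brace [OF C])
  note Cc = subbrace_closed [OF C] and Ic = subbrace_closed [OF ideal_imp_subbrace [OF I]]
  have car: "x \<in> carrier B" if "x \<in> C" for x using that Cc(1) by blast
  have "(\<exists>j\<in>I \<inter> C. x \<oplus> i = j \<oplus> x) \<and> (\<exists>j\<in>I \<inter> C. x \<otimes> i = x \<oplus> j) \<and> (\<exists>j\<in>I \<inter> C. x \<otimes> i = j \<otimes> x)"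
    if x: "x \<in> C" and i: "i \<in> I \<inter> C" for x i
  proof -
    have xi [simp]: "x \<in> carrier B" "i \<in> carrier B" using x i car by auto
    obtain j k where j: "j \<in> I" "x \<oplus> i = j \<oplus> x" and k: "k \<in> I" "x \<otimes> i = k \<otimes> x"
      using I xi i unfolding brace_ideal_iff by (meson IntD1)
    have jk: "j \<in> carrier B" "k \<in> carrier B" using j k Ic(1) by auto
    have "(x \<oplus> i) \<oplus> \<ominus> x = j" "(x \<otimes> i) \<otimes> inv x = k"
      unfolding j k using jk by (simp_all add: add.m_assoc m_assoc)
    moreover have "(x \<oplus> i) \<oplus> \<ominus> x \<in> C" "(x \<otimes> i) \<otimes> inv x \<in> C"
      using x i by (auto intro!: Cc(3-6))
    ultimately have "j \<in> C" "k \<in> C" by simp_all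
    moreover have "lam x i \<in> I \<inter> C" using ideal_lam_closed [OF I] Cc(7) x i by simp
    moreover have "x \<otimes> i = x \<oplus> lam x i" using mult_eq_add_lam by simp
    ultimately show ?thesis using j k by blast
  qed
  moreover have "\<exists>b\<in>I \<inter> C. a \<oplus> b = \<zero>" if "a \<in> I \<inter> C" for a
    using that Ic(5) Cc(5) car by (intro bexI [of _ "\<ominus> a"]) auto
  ultimately show ?thesis
    unfolding C.brace_ideal_iff using Ic(2,3) Cc(2,3) by auto
qed

lemma socle_restrict:
  assumes C: "subbrace C B" shows "socle B \<inter> C \<subseteq> socle (B\<lparr>carrier := C\<rparr>)"
proof
  interpret C: skew_brace "B\<lparr>carrier := C\<rparr>" by (rule subbrace_restrict_is_skew_brace [OF C])
  fix a assume a: "a \<in> socle B \<inter> C"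
  have "a \<otimes> b = a \<oplus> b" "a \<oplus> b = b \<oplus> a" if "b \<in> C" for b
    using a that subbrace_closed(1) [OF C] socle_mult [of a b] socle_comm [of a b] by auto
  then show "a \<in> socle (B\<lparr>carrier := C\<rparr>)" using a by (simp add: C.mem_socle_iff)
qed

lemma rel_center_restrict:
  assumes C: "subbrace C B" and S: "S \<subseteq> carrier B"
  shows "rel_center B S \<inter> C \<subseteq> rel_center (B\<lparr>carrier := C\<rparr>) (S \<inter> C)"
proof
  note Cc = subbrace_closed [OF C]
  have *: "x \<in> (S \<inter> C) +> y" if "x \<in> S +> y" "x \<in> C" "y \<in> C" for x y
  proof -
    obtain s where s: "s \<in> S" "x = s \<oplus> y" using \<open>x \<in> S +> y\<close> by (auto simp: a_r_coset_def')
    have "s = x \<oplus> \<ominus> y" using s S that Cc(1) by (auto simp: add.m_assoc subset_iff)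
    then have "s \<in> C" using that Cc(3,5) by blast
    then show ?thesis using s by (auto simp: a_r_coset_def')
  qed
  fix a assume a: "a \<in> rel_center B S \<inter> C"
  have "a \<otimes> b \<in> S \<inter> C +> (a \<oplus> b) \<and> a \<oplus> b \<in> S \<inter> C +> (b \<oplus> a) \<and> b \<otimes> a \<in> S \<inter> C +> (b \<oplus> a)"
    if b: "b \<in> C" for b
    using a b Cc(1,3,4) by (intro conjI *) (auto simp: rel_center_def)
  then show "a \<in> rel_center (B\<lparr>carrier := C\<rparr>) (S \<inter> C)"
    using a by (auto simp: rel_center_def a_r_coset_def')
qed

lemma nilpotent_over_restrict:
  assumes C: "subbrace C B" and S: "S \<subseteq> carrier B" and nil: "nilpotent_over B S"
  shows "nilpotent_over (B\<lparr>carrier := C\<rparr>) (S \<inter> C)"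
proof -
  let ?C = "B\<lparr>carrier := C\<rparr>"
  have "(rel_center B ^^ n) S \<inter> C \<subseteq> (rel_center ?C ^^ n) (S \<inter> C)" for n
  proof (induction n)
    case (Suc n)
    have "(rel_center B ^^ Suc n) S \<inter> C \<subseteq> rel_center ?C ((rel_center B ^^ n) S \<inter> C)"
      using rel_center_restrict [OF C rel_center_iterate_subset [OF S]] by simp
    also have "\<dots> \<subseteq> (rel_center ?C ^^ Suc n) (S \<inter> C)"
      using rel_center_mono [OF Suc.IH] by simp
    finally show ?case .
  qed simp
  moreover obtain n where "(rel_center B ^^ n) S = carrier B"
    using nil by (auto simp: nilpotent_over_def)
  ultimately have "C \<subseteq> (rel_center ?C ^^ n) (S \<inter> C)"
    using subbrace_closed(1) [OF C] by blast
  moreover have "(rel_center ?C ^^ n) (S \<inter> C) \<subseteq> C"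
    using rel_center_iterate_subset [of "S \<inter> C" ?C n] by simp
  ultimately show ?thesis by (auto simp: nilpotent_over_def)
qed

end

lemma nilpotent_over_iterate:
  assumes "nilpotent_over B ((rel_center B ^^ m) S)" shows "nilpotent_over B S"
proof -
  obtain n where "(rel_center B ^^ n) ((rel_center B ^^ m) S) = carrier B"
    using assms by (auto simp: nilpotent_over_def)
  then have "(rel_center B ^^ (n + m)) S = carrier B" by (simp add: funpow_add)
  then show ?thesis unfolding nilpotent_over_def by blast
qed

lemma (in brace_epi) pull_restrict:
  assumes "brace_epi (K\<lparr>carrier := D\<rparr>) Q' f" "D \<subseteq> carrier K"
  shows "brace_epi.pull (K\<lparr>carrier := D\<rparr>) f S = D \<inter> pull S"
  using assms(2) by (auto simp: pull_def brace_epi.pull_def [OF assms(1)])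

lemma (in brace_epi) socle_image:
  assumes "S \<subseteq> socle K" shows "f ` S \<subseteq> socle Q"
proof
  fix q assume "q \<in> f ` S"
  then obtain a where a: "a \<in> socle K" "q = f a" using assms by auto
  have "f a \<otimes>\<^bsub>Q\<^esub> f x = f a \<oplus>\<^bsub>Q\<^esub> f x" "f a \<oplus>\<^bsub>Q\<^esub> f x = f x \<oplus>\<^bsub>Q\<^esub> f a" if "x \<in> carrier K" for x
    using socle_mult [OF a(1) that] socle_comm [OF a(1) that] socle_closed [OF a(1)] that
    by (metis hom_add hom_mult)+
  then show "q \<in> socle Q"
    using socle_closed [OF a(1)] unfolding a(2) Q.mem_socle_iff surj [symmetric] by blast
qed

section \<open>Supplements of an ideal in the socle\<close>

context skew_brace
begin

text \<open>
  An analogue of the theorem that a group is nilpotent if it is so modulo a normal subgroup of its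
  Frattini subgroup. For an ideal \<open>M\<close> maximal with \<open>B / M\<close> not centrally nilpotent, the centre of
  \<open>B / M\<close> is trivial, and a minimal ideal of \<open>B / M\<close> in the image of \<open>N\<close> has a proper supplement
  there; its preimage is a proper supplement of \<open>N\<close>.
\<close>

lemma nilpotent_if_no_supplement:
  assumes fin: "finite (carrier B)" and N: "brace_ideal N B" and soc: "N \<subseteq> socle B"
    and nil: "nilpotent_over B N"
    and no_suppl: "\<And>L. \<lbrakk>subbrace L B; \<forall>x\<in>carrier B. \<exists>n\<in>N. \<exists>l\<in>L. x = n \<oplus> l\<rbrakk> \<Longrightarrow> L = carrier B"
  shows "nilpotent_over B {\<zero>}"
proof (rule ccontr)
  assume contr: "\<not> ?thesis"
  let ?bad = "{I. brace_ideal I B \<and> \<not> nilpotent_over B I}"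
  have "?bad \<subseteq> Pow (carrier B)" by (auto simp: brace_ideal_iff)
  then have "finite ?bad" using fin finite_subset by blast
  moreover have "?bad \<noteq> {}" using contr zero_ideal by blast
  ultimately obtain M where M: "brace_ideal M B" "\<not> nilpotent_over B M"
    and maximal: "\<And>I. \<lbrakk>brace_ideal I B; M \<subseteq> I; I \<noteq> M\<rbrakk> \<Longrightarrow> nilpotent_over B I"
    using finite_has_maximal [of ?bad] by blast
  have Mcar: "M \<subseteq> carrier B" using M by (simp add: brace_ideal_iff)
  let ?Q = "B Quot M"
  interpret q: brace_epi B ?Q "(+>) M" by (rule quotient_epi [OF M(1)])
  have ker: "q.pull {\<zero>\<^bsub>?Q\<^esub>} = M"
    using Mcar quotient_kernel [OF M(1)] by (auto simp: q.pull_def)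
  have imM: "(+>) M ` M = {\<zero>\<^bsub>?Q\<^esub>}"
    using q.image_pull [of "{\<zero>\<^bsub>?Q\<^esub>}"] ker by simp
  have finQ: "finite (carrier ?Q)" using fin q.surj finite_imageI by metis
  \<comment> \<open>A nontrivial centre would have a centrally nilpotent quotient, hence make \<open>B / M\<close> nilpotent.\<close>
  have center: "brace_center ?Q = {\<zero>\<^bsub>?Q\<^esub>}"
  proof -
    have "rel_center B M = M"
      using maximal [OF rel_center_ideal [OF M(1)] ideal_subset_rel_center [OF M(1)]]
        nilpotent_over_iterate [of B 1 M] M(2) by auto
    then have "q.pull (brace_center ?Q) = M"
      by (simp add: rel_center_eq_quotient [OF M(1)] q.pull_def)
    moreover have "brace_center ?Q \<subseteq> carrier ?Q" using q.Q.mem_center_iff by blast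
    ultimately show ?thesis using q.image_pull imM by metis
  qed
  let ?T = "(+>) M ` N"
  have T: "brace_ideal ?T ?Q" "?T \<subseteq> socle ?Q"
    by (rule q.ideal_image [OF N], rule q.socle_image [OF soc])
  have "?T \<noteq> {\<zero>\<^bsub>?Q\<^esub>}"
  proof
    assume "?T = {\<zero>\<^bsub>?Q\<^esub>}"
    then have "M +> n = \<zero>\<^bsub>?Q\<^esub>" if "n \<in> N" for n using that by blast
    then have "N \<subseteq> M"
      using quotient_kernel [OF M(1)] subbrace_closed(1) [OF ideal_imp_subbrace [OF N]] by blast
    then show False using nilpotent_over_mono [OF nil _ Mcar] M(2) by blast
  qed
  let ?A = "{I. brace_ideal I ?Q \<and> I \<noteq> {\<zero>\<^bsub>?Q\<^esub>} \<and> I \<subseteq> ?T}"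
  have "?A \<subseteq> Pow (carrier ?Q)" by (auto simp: q.Q.brace_ideal_iff)
  then have "finite ?A" using finQ finite_subset by blast
  moreover have "?T \<in> ?A" using T \<open>?T \<noteq> _\<close> by blast
  ultimately obtain P where P: "brace_ideal P ?Q" "P \<noteq> {\<zero>\<^bsub>?Q\<^esub>}" "P \<subseteq> ?T"
    and Pmin: "\<And>I. \<lbrakk>brace_ideal I ?Q; I \<noteq> {\<zero>\<^bsub>?Q\<^esub>}; I \<subseteq> P\<rbrakk> \<Longrightarrow> I = P"
    using finite_has_minimal2 [of ?A ?T] by (smt (verit) mem_Collect_eq order_trans)
  have Pcar: "P \<subseteq> carrier ?Q" using P by (simp add: q.Q.brace_ideal_iff)
  have "nilpotent_over B (q.pull P)"
  proof (rule maximal [OF q.ideal_pull [OF P(1)]])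
    show "M \<subseteq> q.pull P"
      using q.pull_mono [of "{\<zero>\<^bsub>?Q\<^esub>}" P] ker q.Q.subbrace_closed(2) [OF q.Q.ideal_imp_subbrace [OF P(1)]] by simp
    show "q.pull P \<noteq> M"
    proof
      assume "q.pull P = M"
      then have "P = {\<zero>\<^bsub>?Q\<^esub>}" using q.image_pull [OF Pcar] imM by simp
      then show False using P(2) by blast
    qed
  qed
  then have nil_P: "nilpotent_over ?Q P" using q.nilpotent_over_pull_iff [OF Pcar] by blast
  have "\<exists>L. subbrace L ?Q \<and> L \<noteq> carrier ?Q \<and> (\<forall>x\<in>carrier ?Q. \<exists>p\<in>P. \<exists>l\<in>L. x = p \<oplus>\<^bsub>?Q\<^esub> l)"
    by (rule q.Q.minimal_ideal_supplement [OF finQ center P(1,2) order_trans [OF P(3) T(2)] _ nil_P])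
      (use Pmin in blast)
  then obtain L where L: "subbrace L ?Q" "L \<noteq> carrier ?Q"
    and suppl: "\<forall>x\<in>carrier ?Q. \<exists>p\<in>P. \<exists>l\<in>L. x = p \<oplus>\<^bsub>?Q\<^esub> l"
    by (elim exE conjE)
  have "q.pull L = carrier B"
  proof (rule no_suppl [OF q.subbrace_pull [OF L(1)]], rule ballI)
    fix x assume x: "x \<in> carrier B"
    then obtain p l where p: "p \<in> P" "l \<in> L" "M +> x = p \<oplus>\<^bsub>?Q\<^esub> l"
      using suppl q.hom_closed by meson
    then obtain n where n: "n \<in> N" "p = M +> n" using P(3) by blast
    have [simp]: "n \<in> carrier B" using n N by (auto simp: brace_ideal_iff)
    have "l \<in> carrier ?Q" using p L(1) q.Q.subbrace_closed(1) by blast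
    then have "M +> (\<ominus> n \<oplus> x) = l"
      using x p n by (simp add: q.hom_add q.hom_minus q.Q.add.m_assoc [symmetric])
    then have "\<ominus> n \<oplus> x \<in> q.pull L" using p x by (simp add: q.pull_def)
    moreover have "x = n \<oplus> (\<ominus> n \<oplus> x)" using x by (simp add: add.m_assoc [symmetric])
    ultimately show "\<exists>n\<in>N. \<exists>l\<in>q.pull L. x = n \<oplus> l" using n by blast
  qed
  then have "L = carrier ?Q"
    using q.image_pull [of L] q.Q.subbrace_closed(1) [OF L(1)] q.surj by metis
  then show False using L(2) by blast
qed

text \<open>
  A minimal supplement of \<open>N\<close> is centrally nilpotent by the preceding lemma. This only shows that there
  are centrally nilpotent supplements; a minimal one need not be self-idealising (in a trivial skew
  brace \<open>B = N\<close> it is zero). The Carter subbrace is a maximal one \<open>H\<close>: if \<open>H\<close> were an ideal of a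
  larger \<open>D\<close>, then \<open>D\<close> would be centrally nilpotent, its upper central series swallowing
  successively \<open>H \<inter> N\<close>, \<open>D \<inter> N\<close> and \<open>D\<close>.
\<close>

lemma carter_supplement:
  assumes fin: "finite (carrier B)" and N: "brace_ideal N B" and soc: "N \<subseteq> socle B"
    and nil: "nilpotent_over B N"
  shows "\<exists>H. subbrace H B \<and> (\<forall>x\<in>carrier B. \<exists>n\<in>N. \<exists>h\<in>H. x = n \<oplus> h) \<and>
    nilpotent_over (B\<lparr>carrier := H\<rparr>) {\<zero>} \<and> self_idealising H B"
proof -
  note Nc = subbrace_closed [OF ideal_imp_subbrace [OF N]]
  define suppl where "suppl H \<longleftrightarrow> subbrace H B \<and> (\<forall>x\<in>carrier B. \<exists>n\<in>N. \<exists>h\<in>H. x = n \<oplus> h)" for H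
  have "{H. suppl H} \<subseteq> Pow (carrier B)" using subbrace_closed(1) unfolding suppl_def by blast
  then have finite: "finite {H. suppl H}" using fin finite_subset by blast
  have "suppl (carrier B)"
    unfolding suppl_def
  proof (intro conjI ballI carrier_subbrace)
    fix x assume "x \<in> carrier B"
    then show "\<exists>n\<in>N. \<exists>h\<in>carrier B. x = n \<oplus> h" using Nc(2) by (intro bexI [of _ "\<zero>"] bexI [of _ x]) auto
  qed
  then obtain M where M: "suppl M" and Mmin: "\<And>L. \<lbrakk>suppl L; L \<subseteq> M\<rbrakk> \<Longrightarrow> L = M"
    using finite_has_minimal [OF finite] by blast
  have Msub: "subbrace M B" using M by (simp add: suppl_def)
  have "nilpotent_over (B\<lparr>carrier := M\<rparr>) {\<zero>}"
  proof -
    interpret M: skew_brace "B\<lparr>carrier := M\<rparr>" by (rule subbrace_restrict_is_skew_brace [OF Msub])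
    have "nilpotent_over (B\<lparr>carrier := M\<rparr>) {\<zero>\<^bsub>B\<lparr>carrier := M\<rparr>\<^esub>}"
    proof (rule M.nilpotent_if_no_supplement)
      show "finite (carrier (B\<lparr>carrier := M\<rparr>))"
        using fin subbrace_closed(1) [OF Msub] finite_subset by simp
      show "brace_ideal (N \<inter> M) (B\<lparr>carrier := M\<rparr>)" by (rule ideal_restrict [OF N Msub])
      show "N \<inter> M \<subseteq> socle (B\<lparr>carrier := M\<rparr>)" using socle_restrict [OF Msub] soc by blast
      show "nilpotent_over (B\<lparr>carrier := M\<rparr>) (N \<inter> M)"
        by (rule nilpotent_over_restrict [OF Msub Nc(1) nil])
      fix L assume L: "subbrace L (B\<lparr>carrier := M\<rparr>)"
        and LM: "\<forall>x\<in>carrier (B\<lparr>carrier := M\<rparr>). \<exists>n\<in>N \<inter> M. \<exists>l\<in>L. x = n \<oplus>\<^bsub>B\<lparr>carrier := M\<rparr>\<^esub> l"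
      have L': "subbrace L B" "L \<subseteq> M" using L subbrace_restrict_iff [OF Msub] by blast+
      have "suppl L"
        unfolding suppl_def
      proof (intro conjI ballI L'(1))
        fix x assume "x \<in> carrier B"
        then obtain n m where n: "n \<in> N" "m \<in> M" "x = n \<oplus> m" using M unfolding suppl_def by blast
        moreover obtain n' l where n': "n' \<in> N" "l \<in> L" "m = n' \<oplus> l" using LM n(2) by auto
        ultimately have "x = (n \<oplus> n') \<oplus> l"
          using Nc(1) subbrace_closed(1) [OF L'(1)] by (auto simp: add.m_assoc subset_iff)
        then show "\<exists>n\<in>N. \<exists>h\<in>L. x = n \<oplus> h" using Nc(3) n(1) n'(1,2) by blast
      qed
      then show "L = carrier (B\<lparr>carrier := M\<rparr>)" using Mmin L'(2) by simp
    qed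
    then show ?thesis by simp
  qed
  then have "M \<in> {H. suppl H \<and> nilpotent_over (B\<lparr>carrier := H\<rparr>) {\<zero>}}" using M by blast
  moreover have "finite {H. suppl H \<and> nilpotent_over (B\<lparr>carrier := H\<rparr>) {\<zero>}}"
    using finite by (rule rev_finite_subset) blast
  ultimately obtain H where H: "suppl H" "nilpotent_over (B\<lparr>carrier := H\<rparr>) {\<zero>}"
    and Hmax: "\<And>D. \<lbrakk>suppl D; nilpotent_over (B\<lparr>carrier := D\<rparr>) {\<zero>}; H \<subseteq> D\<rbrakk> \<Longrightarrow> H = D"
    using finite_has_maximal [of "{H. suppl H \<and> nilpotent_over (B\<lparr>carrier := H\<rparr>) {\<zero>}}"] by blast
  have Hsub: "subbrace H B" using H(1) by (simp add: suppl_def)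
  note Hc = subbrace_closed [OF Hsub]
  have False if D: "subbrace D B" "H \<subset> D" "brace_ideal H (B\<lparr>carrier := D\<rparr>)" for D
  proof -
    let ?D = "B\<lparr>carrier := D\<rparr>" and ?H = "B\<lparr>carrier := H\<rparr>"
    interpret D: skew_brace ?D by (rule subbrace_restrict_is_skew_brace [OF D(1)])
    note Dc = subbrace_closed [OF D(1)]
    have Dsuppl: "suppl D" using H(1) D(1,2) unfolding suppl_def by blast
    have coeff_in_N: "s \<in> N"
      if h: "h \<in> carrier B" and a: "a \<in> N" and s: "s \<in> carrier B" "h \<otimes> a = s \<oplus> (h \<oplus> a)" for h a s
    proof -
      have as: "a \<in> socle B" and [simp]: "a \<in> carrier B" using a soc Nc(1) by auto
      have "lam h a \<oplus> h = h \<otimes> a"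
        using socle_conj_eq_lam [OF as h] socle_mult [of "lam h a" h] h by simp
      also have "\<dots> = (s \<oplus> a) \<oplus> h"
        using socle_comm [OF as h] h s by (simp add: add.m_assoc)
      finally have "lam h a = s \<oplus> a" using h s(1) by simp
      then have "s = lam h a \<oplus> \<ominus> a" using s(1) by (simp add: add.m_assoc)
      then show ?thesis using ideal_lam_closed [OF N h a] Nc(3,5) a by blast
    qed
    \<comment> \<open>Since \<open>D = H (D \<inter> N)\<close> and \<open>N\<close> acts trivially on itself, only \<open>H\<close> matters for
      centrality of an element of \<open>N\<close>.\<close>
    have in_center: "a \<in> rel_center ?D S"
      if S: "\<zero> \<in> S" and a: "a \<in> D" "a \<in> N"
        and twist: "\<And>h. h \<in> H \<Longrightarrow> \<exists>s\<in>S \<inter> N. h \<otimes> a = s \<oplus> (h \<oplus> a)" for a S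
    proof -
      have as: "a \<in> socle B" and [simp]: "a \<in> carrier B" using a soc Nc(1) by auto
      have self: "x \<in> S +> x" if "x \<in> carrier B" for x
        using S that by (auto simp: a_r_coset_def' intro!: bexI [of _ \<zero>])
      have "a \<otimes> b \<in> S +> (a \<oplus> b) \<and> a \<oplus> b \<in> S +> (b \<oplus> a) \<and> b \<otimes> a \<in> S +> (b \<oplus> a)"
        if b: "b \<in> D" for b
      proof -
        have [simp]: "b \<in> carrier B" using b Dc(1) by auto
        have ab: "a \<otimes> b = a \<oplus> b" "a \<oplus> b = b \<oplus> a"
          using socle_mult [OF as] socle_comm [OF as] by simp_all
        obtain n h where n: "n \<in> N" "h \<in> H" "b = n \<oplus> h" 
          using H(1) \<open>b \<in> carrier B\<close> unfolding suppl_def by blast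
        have [simp]: "n \<in> carrier B" "h \<in> carrier B" using n Nc(1) Hc(1) by auto
        define n' where "n' = lam (inv h) n"
        have n'N: "n' \<in> N" unfolding n'_def using ideal_lam_closed [OF N _ n(1)] by simp
        then have n's: "n' \<in> socle B" and [simp]: "n' \<in> carrier B" using soc Nc(1) by auto
        have bh: "b = h \<otimes> n'"
          using socle_comm [of n h] soc n(1) add_eq_mult_lam_inv [of h n] by (auto simp: n(3) n'_def)
        have an: "n' \<otimes> a = a \<otimes> n'"
          using socle_mult [OF n's, of a] socle_mult [OF as, of n'] socle_comm [OF as, of n'] by simp
        obtain s where s: "s \<in> S" "s \<in> N" "h \<otimes> a = s \<oplus> (h \<oplus> a)" using twist n(2) by blast
        have ss: "s \<in> socle B" and [simp]: "s \<in> carrier B" using s soc Nc(1) by auto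
        have "h \<otimes> a = s \<otimes> (a \<otimes> h)"
          using s(3) socle_mult [OF ss, of "a \<oplus> h"] socle_mult [OF as, of h] socle_comm [OF as, of h] by simp
        then have "b \<otimes> a = s \<otimes> (a \<otimes> b)"
          unfolding bh using an by (simp add: m_assoc) (simp add: m_assoc [symmetric])
        also have "\<dots> = s \<oplus> (b \<oplus> a)" using ab socle_mult [OF ss, of "a \<otimes> b"] by simp
        finally have "b \<otimes> a \<in> S +> (b \<oplus> a)" using s by (auto simp: a_r_coset_def')
        then show ?thesis using self ab by simp
      qed
      then show ?thesis using a by (auto simp: rel_center_def a_r_coset_def')
    qed
    define U where "U n = (rel_center ?D ^^ n) {\<zero>}" for n
    have U0: "\<zero> \<in> U n" for n
      using D.rel_center_iterate_ideal [OF D.zero_ideal, of n] unfolding U_def D.brace_ideal_iff by simp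
    have HU: "(rel_center ?H ^^ n) {\<zero>} \<inter> N \<subseteq> U n" for n
    proof (induction n)
      case 0
      show ?case by (auto simp: U_def)
    next
      case (Suc n)
      show ?case
      proof
        fix a assume "a \<in> (rel_center ?H ^^ Suc n) {\<zero>} \<inter> N"
        then have a: "a \<in> rel_center ?H ((rel_center ?H ^^ n) {\<zero>})" "a \<in> N" by auto
        have aH: "a \<in> H" using a(1) by (simp add: rel_center_def)
        have "a \<in> rel_center ?D (U n)"
        proof (rule in_center [OF U0 _ a(2)])
          show "a \<in> D" using aH D(2) by blast
          fix h assume h: "h \<in> H"
          then obtain s where s: "s \<in> (rel_center ?H ^^ n) {\<zero>}" "h \<otimes> a = s \<oplus> (h \<oplus> a)"
            using a(1) by (auto simp: rel_center_def a_r_coset_def')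
          have "s \<in> H" using s(1) rel_center_iterate_subset [of "{\<zero>}" ?H n] Hc(2) by auto
          then have "s \<in> N" using coeff_in_N [OF _ a(2) _ s(2)] h Hc(1) by blast
          then show "\<exists>s\<in>U n \<inter> N. h \<otimes> a = s \<oplus> (h \<oplus> a)" using s Suc.IH by blast
        qed
        then show "a \<in> U (Suc n)" by (simp add: U_def)
      qed
    qed
    obtain n where n: "(rel_center ?H ^^ n) {\<zero>} = H" using H(2) by (auto simp: nilpotent_over_def)
    \<comment> \<open>As \<open>H\<close> is an ideal of \<open>D\<close>, it acts trivially on \<open>D\<close> modulo \<open>H\<close>.\<close>
    have "N \<inter> D \<subseteq> U (Suc n)"
    proof
      fix a assume a: "a \<in> N \<inter> D"
      have "a \<in> rel_center ?D (U n)"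
      proof (rule in_center [OF U0])
        fix h assume h: "h \<in> H"
        have car: "h \<in> carrier B" "a \<in> carrier B" using h a Hc(1) Nc(1) by auto
        have "h \<otimes> a \<in> H +> a"
          using D.ideal_coset_iff [OF D(3), of a "h \<otimes> a"] a h by (auto simp: a_r_coset_def')
        then obtain h' where h': "h' \<in> H" "h \<otimes> a = h' \<oplus> a" by (auto simp: a_r_coset_def')
        define s where "s = h' \<oplus> \<ominus> h"
        have sH: "s \<in> H" unfolding s_def using h h' Hc(3,5) by blast
        have eq: "h \<otimes> a = s \<oplus> (h \<oplus> a)"
          unfolding s_def h'(2) using car h'(1) Hc(1) by (auto simp: add.m_assoc subset_iff) (simp add: add.m_assoc [symmetric])
        have "s \<in> N" using coeff_in_N [OF car(1) _ _ eq] a sH Hc(1) by blast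
        then show "\<exists>s\<in>U n \<inter> N. h \<otimes> a = s \<oplus> (h \<oplus> a)" using eq sH HU [of n] n by blast
      qed (use a in auto)
      then show "a \<in> U (Suc n)" by (simp add: U_def)
    qed
    then have "nilpotent_over ?D (U (Suc n))"
      using nilpotent_over_mono [OF nilpotent_over_restrict [OF D(1) Nc(1) nil]]
        rel_center_iterate_subset [of "{\<zero>}" ?D "Suc n"] Dc(2) unfolding U_def by simp
    then have "nilpotent_over ?D {\<zero>}" unfolding U_def by (rule nilpotent_over_iterate)
    then show False using Hmax [OF Dsuppl] D(2) by blast
  qed
  then have "self_idealising H B" unfolding self_idealising_def by blast
  then show ?thesis using H unfolding suppl_def by blast
qed

text \<open>
  If \<open>H\<close> is an ideal of \<open>D\<close>, then the image of \<open>H\<close>, which is the image of \<open>C\<close>, is an ideal of the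
  image of \<open>D\<close> in \<open>B / N\<close>; hence \<open>C\<close> is an ideal of the preimage \<open>E = D + N\<close>. As \<open>C\<close> is
  self-idealising, \<open>D\<close> lies in \<open>C\<close>, where \<open>H\<close> is self-idealising.
\<close>

lemma carter_refine:
  assumes fin: "finite (carrier B)" and N: "brace_ideal N B" and soc: "N \<subseteq> socle B"
    and C: "subbrace C B" "N \<subseteq> C" "nilpotent_over (B\<lparr>carrier := C\<rparr>) N" "self_idealising C B"
  shows "\<exists>H. subbrace H B \<and> nilpotent_over (B\<lparr>carrier := H\<rparr>) {\<zero>} \<and> self_idealising H B"
proof -
  let ?C = "B\<lparr>carrier := C\<rparr>"
  interpret C: skew_brace ?C by (rule subbrace_restrict_is_skew_brace [OF C(1)])
  have NC: "N \<inter> C = N" using C(2) by blast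
  have "finite (carrier ?C)" using fin subbrace_closed(1) [OF C(1)] finite_subset by simp
  moreover have "brace_ideal N ?C" using ideal_restrict [OF N C(1)] NC by simp
  moreover have "N \<subseteq> socle ?C" using socle_restrict [OF C(1)] soc C(2) by blast
  ultimately obtain H where H: "subbrace H ?C" "\<forall>x\<in>C. \<exists>n\<in>N. \<exists>h\<in>H. x = n \<oplus> h"
    "nilpotent_over (B\<lparr>carrier := H\<rparr>) {\<zero>}" "self_idealising H ?C"
    using C.carter_supplement [OF _ _ _ C(3)] by auto
  have Hsub: "subbrace H B" "H \<subseteq> C" using H(1) subbrace_restrict_iff [OF C(1)] by blast+
  interpret g: brace_epi B "B Quot N" "(+>) N" by (rule quotient_epi [OF N])
  let ?g = "(+>) N"
  have ker: "g.pull {\<zero>\<^bsub>B Quot N\<^esub>} = N"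
    using N quotient_kernel [OF N] by (auto simp: g.pull_def brace_ideal_iff)
  have pullH: "g.pull (?g ` H) = C"
  proof
    have "g.pull (?g ` C) = C" using g.pull_image [OF C(1)] C(2) ker by blast
    then show "g.pull (?g ` H) \<subseteq> C" using Hsub(2) g.pull_mono image_mono by metis
    show "C \<subseteq> g.pull (?g ` H)"
    proof
      fix x assume x: "x \<in> C"
      then obtain n h where nh: "n \<in> N" "h \<in> H" "x = n \<oplus> h" using H(2) by blast
      have car: "n \<in> carrier B" "h \<in> carrier B" "x \<in> carrier B"
        using nh x N subbrace_closed(1) [OF C(1)] Hsub(2) by (auto simp: brace_ideal_iff)
      have "N +> n = \<zero>\<^bsub>B Quot N\<^esub>" using quotient_kernel [OF N] nh car by simp
      then have "N +> x = N +> h" using car by (simp add: nh(3) g.hom_add)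
      then show "x \<in> g.pull (?g ` H)" using nh(2) car by (auto simp: g.pull_def)
    qed
  qed
  have False if D: "subbrace D B" "H \<subset> D" "brace_ideal H (B\<lparr>carrier := D\<rparr>)" for D
  proof -
    let ?gD = "?g ` D"
    have gD: "subbrace ?gD (B Quot N)" by (rule g.subbrace_image [OF D(1)])
    have gDcar: "?gD \<subseteq> carrier (B Quot N)" using gD g.Q.subbrace_closed(1) by blast
    let ?E = "g.pull ?gD"
    have E: "subbrace ?E B" by (rule g.subbrace_pull [OF gD])
    interpret d: brace_epi "B\<lparr>carrier := D\<rparr>" "(B Quot N)\<lparr>carrier := ?gD\<rparr>" ?g
      by (rule g.restrict_epi [OF D(1) gD refl])
    interpret e: brace_epi "B\<lparr>carrier := ?E\<rparr>" "(B Quot N)\<lparr>carrier := ?gD\<rparr>" ?g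
      by (rule g.restrict_epi [OF E gD g.image_pull [OF gDcar]])
    have "e.pull (?g ` H) = g.pull (?g ` H)"
      using g.pull_restrict [OF e.brace_epi_axioms g.pull_subset] g.pull_mono [of "?g ` H" ?gD] D(2) by blast
    then have "brace_ideal C (B\<lparr>carrier := ?E\<rparr>)"
      using e.ideal_pull [OF d.ideal_image [OF D(3)]] pullH by simp
    moreover have "C \<subseteq> ?E" using pullH D(2) g.pull_mono [of "?g ` H" ?gD] by blast
    ultimately have "?E = C" using C(4) E unfolding self_idealising_def by blast
    then have "D \<subseteq> C" using subbrace_closed(1) [OF D(1)] by (auto simp: g.pull_def)
    then have "subbrace D ?C" using D(1) subbrace_restrict_iff [OF C(1)] by blast
    then show False using H(4) D(2,3) unfolding self_idealising_def by auto
  qed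
  then show ?thesis using H(3) Hsub(1) unfolding self_idealising_def by blast
qed

end

text \<open>
  One step down the socle series. With \<open>Q = B / S\<^sub>i\<close> the two preimages are \<open>S\<^sub>i\<^sub>+\<^sub>1\<close> and \<open>S\<^sub>i\<close>; stating
  the step for preimages keeps all terms of the series in the same skew brace.
\<close>

lemma (in brace_epi) carter_lift:
  assumes fin: "finite (carrier K)"
    and C: "subbrace C K" "pull (socle Q) \<subseteq> C" "nilpotent_over (K\<lparr>carrier := C\<rparr>) (pull (socle Q))"
      "self_idealising C K"
  shows "\<exists>H. subbrace H K \<and> pull {\<zero>\<^bsub>Q\<^esub>} \<subseteq> H \<and>
    nilpotent_over (K\<lparr>carrier := H\<rparr>) (pull {\<zero>\<^bsub>Q\<^esub>}) \<and> self_idealising H K"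
proof -
  have socQ: "socle Q \<subseteq> carrier Q" "\<zero>\<^bsub>Q\<^esub> \<in> socle Q"
    using Q.socle_closed Q.socle_zero by blast+
  have fC: "subbrace (f ` C) Q" by (rule subbrace_image [OF C(1)])
  have pullC: "pull (f ` C) = C"
    using C(2) socQ(2) pull_mono [of "{\<zero>\<^bsub>Q\<^esub>}" "socle Q"] by (intro pull_image [OF C(1)]) auto
  have socC: "socle Q \<subseteq> f ` C" using image_pull [OF socQ(1)] C(2) by blast
  have "\<exists>H. subbrace H Q \<and> nilpotent_over (Q\<lparr>carrier := H\<rparr>) {\<zero>\<^bsub>Q\<^esub>} \<and> self_idealising H Q"
  proof (rule Q.carter_refine [OF _ Q.socle_ideal subset_refl fC socC])
    show "finite (carrier Q)" using fin surj finite_imageI by metis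
    interpret c: brace_epi "K\<lparr>carrier := C\<rparr>" "Q\<lparr>carrier := f ` C\<rparr>" f
      by (rule restrict_epi [OF C(1) fC refl])
    have "c.pull (socle Q) = pull (socle Q)"
      using pull_restrict [OF c.brace_epi_axioms subbrace_closed(1) [OF C(1)]] C(2) by blast
    then show "nilpotent_over (Q\<lparr>carrier := f ` C\<rparr>) (socle Q)"
      using C(3) c.nilpotent_over_pull_iff [of "socle Q"] socC by simp
    have False if D: "subbrace D Q" "f ` C \<subset> D" "brace_ideal (f ` C) (Q\<lparr>carrier := D\<rparr>)" for D
    proof -
      have Dcar: "D \<subseteq> carrier Q" using Q.subbrace_closed(1) [OF D(1)] .
      have pD: "subbrace (pull D) K" by (rule subbrace_pull [OF D(1)])
      interpret d: brace_epi "K\<lparr>carrier := pull D\<rparr>" "Q\<lparr>carrier := D\<rparr>" f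
        by (rule restrict_epi [OF pD D(1) image_pull [OF Dcar]])
      have "d.pull (f ` C) = pull (f ` C)"
        using pull_restrict [OF d.brace_epi_axioms pull_subset] pull_mono [of "f ` C" D] D(2) by blast
      then have "brace_ideal C (K\<lparr>carrier := pull D\<rparr>)"
        using d.ideal_pull [OF D(3)] pullC by simp
      moreover have "C \<subseteq> pull D" using pullC D(2) pull_mono [of "f ` C" D] by blast
      moreover have "C \<noteq> pull D" using image_pull [OF Dcar] D(2) by blast
      ultimately show False using C(4) pD unfolding self_idealising_def by blast
    qed
    then show "self_idealising (f ` C) Q" unfolding self_idealising_def by blast
  qed
  then obtain H where H: "subbrace H Q" "nilpotent_over (Q\<lparr>carrier := H\<rparr>) {\<zero>\<^bsub>Q\<^esub>}" "self_idealising H Q"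
    by blast
  have Hcar: "H \<subseteq> carrier Q" "\<zero>\<^bsub>Q\<^esub> \<in> H" using Q.subbrace_closed(1,2) [OF H(1)] by blast+
  have pH: "subbrace (pull H) K" by (rule subbrace_pull [OF H(1)])
  interpret h: brace_epi "K\<lparr>carrier := pull H\<rparr>" "Q\<lparr>carrier := H\<rparr>" f
    by (rule restrict_epi [OF pH H(1) image_pull [OF Hcar(1)]])
  have "h.pull {\<zero>\<^bsub>Q\<^esub>} = pull {\<zero>\<^bsub>Q\<^esub>}" 
    using pull_restrict [OF h.brace_epi_axioms pull_subset] pull_mono [of "{\<zero>\<^bsub>Q\<^esub>}" H] Hcar(2) by blast
  then have "nilpotent_over (K\<lparr>carrier := pull H\<rparr>) (pull {\<zero>\<^bsub>Q\<^esub>})"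
    using H(2) h.nilpotent_over_pull_iff [of "{\<zero>\<^bsub>Q\<^esub>}"] Hcar(2) by simp
  moreover have False if D: "subbrace D K" "pull H \<subset> D" "brace_ideal (pull H) (K\<lparr>carrier := D\<rparr>)" for D
  proof -
    have fD: "subbrace (f ` D) Q" by (rule subbrace_image [OF D(1)])
    interpret d: brace_epi "K\<lparr>carrier := D\<rparr>" "Q\<lparr>carrier := f ` D\<rparr>" f
      by (rule restrict_epi [OF D(1) fD refl])
    have "brace_ideal H (Q\<lparr>carrier := f ` D\<rparr>)"
      using d.ideal_image [OF D(3)] image_pull [OF Hcar(1)] by simp
    moreover have "H \<subseteq> f ` D" using image_pull [OF Hcar(1)] D(2) by blast
    moreover have "H \<noteq> f ` D"
      using D(2) subbrace_closed(1) [OF D(1)] unfolding pull_def by blast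
    ultimately show False using H(3) fD unfolding self_idealising_def by blast
  qed
  moreover have "pull {\<zero>\<^bsub>Q\<^esub>} \<subseteq> pull H" using Hcar(2) by (intro pull_mono) simp
  ultimately show ?thesis using pH unfolding self_idealising_def by blast
qed

section \<open>Existence of Carter subbraces\<close>

theorem theorem2:
  fixes B :: "('a, 'b) ring_scheme"
  assumes "skew_brace B"
    and "finite (carrier B)"
    and "multipermutational B"
  shows "\<exists>C. carter_subbrace C B"
proof -
  interpret skew_brace B by fact
  define good where "good n \<longleftrightarrow> (\<exists>C. subbrace C B \<and> socle_series B n \<subseteq> C \<and>
    nilpotent_over (B\<lparr>carrier := C\<rparr>) (socle_series B n) \<and> self_idealising C B)" for n
  have step: "good n" if "good (Suc n)" for n
  proof (cases n)
    \<comment> \<open>The first term of the series is \<open>socle B\<close> itself, not a preimage from \<open>B / 0\<close>.\<close>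
    case 0
    interpret i: brace_epi B B id by unfold_locales auto
    have "i.pull (socle B) = socle_series B (Suc n)" "i.pull {\<zero>\<^bsub>B\<^esub>} = socle_series B n"
      using 0 socle_closed by (auto simp: i.pull_def)
    then show ?thesis using i.carter_lift [OF assms(2)] that unfolding good_def by auto
  next
    case (Suc m)
    let ?S = "socle_series B n"
    have S: "brace_ideal ?S B" by (rule socle_series_ideal)
    interpret q: brace_epi B "B Quot ?S" "a_r_coset B ?S" by (rule quotient_epi [OF S])
    have "q.pull (socle (B Quot ?S)) = socle_series B (Suc n)"
      unfolding q.pull_def using Suc by simp
    moreover have "q.pull {\<zero>\<^bsub>B Quot ?S\<^esub>} = ?S"
      using S quotient_kernel [OF S] by (auto simp: q.pull_def brace_ideal_iff)
    ultimately show ?thesis using q.carter_lift [OF assms(2)] that unfolding good_def by auto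
  qed
  obtain n where n: "socle_series B n = carrier B"
    using assms(3) by (auto simp: multipermutational_def)
  have "(rel_center B ^^ 0) (carrier B) = carrier B" by simp
  then have "nilpotent_over B (carrier B)" unfolding nilpotent_over_def by blast
  moreover have "self_idealising (carrier B) B"
    using subbrace_closed(1) unfolding self_idealising_def by blast
  ultimately have "good n" using carrier_subbrace n unfolding good_def by auto
  then have "good 0" using step by (induction n) auto
  then obtain C where C: "subbrace C B" "nilpotent_over (B\<lparr>carrier := C\<rparr>) {\<zero>\<^bsub>B\<^esub>}" "self_idealising C B"
    unfolding good_def by auto
  interpret C: skew_brace "B\<lparr>carrier := C\<rparr>" by (rule subbrace_restrict_is_skew_brace [OF C(1)])
  have "carter_subbrace C B"
    using C C.centrally_nilpotent_iff by (simp add: carter_subbrace_def)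
  then show ?thesis by blast
qed

end
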